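(* Let $A$ be a finite-dimensional algebra over an algebraically closed field $k$. Assume that all simple left $A$-modules are reflexive. If $T$ is a simple left $A$-module such that $S^*$ is a simple right $A$-module for every simple left $A$-module $S$ not isomorphic to $T$, then $T^*$ is also a simple right $A$-module (and $A$ is self-injective).
   Context: Modules have finite length. For a left $A$-module $M$, let $M^*=\operatorname{Hom}_A(M,{}_AA)$, considered as a right $A$-module; similarly, for a right $A$-module $N$, $N^*=\operatorname{Hom}_A(N,A_A)$, considered as a left $A$-module. Let $\phi_M\colon M\to M^{**}$ be the canonical evaluation map $m\mapsto (f\mapsto f(m))$; a module $M$ is reflexive if $\phi_M$ is bijective. The algebra $A$ is self-injective if ${}_AA$ is an injective module. *)

theory Defs
  imports
    "HOL-Algebra.Algebraic_Closure"
    "Jordan_Normal_Form.Missing_VectorSpace"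
begin

text \<open>The libraries only treat modules over commutative rings.  The axioms below are those of
  \<^locale>\<open>module\<close> without commutativity of the ring of scalars, so
  \<open>a \<odot>\<^bsub>M\<^esub> x\<close> is the left action.\<close>

locale left_module = R?: ring R + M?: abelian_group M
  for R :: "('a, 'r) ring_scheme" and M :: "('a, 'b, 'm) module_scheme" +
  assumes smult_closed:
      "\<lbrakk>a \<in> carrier R; x \<in> carrier M\<rbrakk> \<Longrightarrow> a \<odot>\<^bsub>M\<^esub> x \<in> carrier M"
    and smult_l_distr:
      "\<lbrakk>a \<in> carrier R; b \<in> carrier R; x \<in> carrier M\<rbrakk> \<Longrightarrow>
        (a \<oplus>\<^bsub>R\<^esub> b) \<odot>\<^bsub>M\<^esub> x = a \<odot>\<^bsub>M\<^esub> x \<oplus>\<^bsub>M\<^esub> b \<odot>\<^bsub>M\<^esub> x"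
    and smult_r_distr:
      "\<lbrakk>a \<in> carrier R; x \<in> carrier M; y \<in> carrier M\<rbrakk> \<Longrightarrow>
        a \<odot>\<^bsub>M\<^esub> (x \<oplus>\<^bsub>M\<^esub> y) = a \<odot>\<^bsub>M\<^esub> x \<oplus>\<^bsub>M\<^esub> a \<odot>\<^bsub>M\<^esub> y"
    and smult_assoc:
      "\<lbrakk>a \<in> carrier R; b \<in> carrier R; x \<in> carrier M\<rbrakk> \<Longrightarrow>
        (a \<otimes>\<^bsub>R\<^esub> b) \<odot>\<^bsub>M\<^esub> x = a \<odot>\<^bsub>M\<^esub> (b \<odot>\<^bsub>M\<^esub> x)"
    and smult_one:
      "x \<in> carrier M \<Longrightarrow> \<one>\<^bsub>R\<^esub> \<odot>\<^bsub>M\<^esub> x = x"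

lemma module_iff_left_module: "module R M \<longleftrightarrow> cring R \<and> left_module R M"
  by (auto simp: module_def module_axioms_def left_module_def left_module_axioms_def
      cring.axioms(1))

definition opposite_ring :: "('a, 'r) ring_scheme \<Rightarrow> ('a, 'r) ring_scheme"
  where "opposite_ring R = R\<lparr>monoid.mult := \<lambda>x y. y \<otimes>\<^bsub>R\<^esub> x\<rparr>"

lemma opposite_opposite_ring [simp]: "opposite_ring (opposite_ring R) = R"
  by (simp add: opposite_ring_def)

text \<open>A right \<open>R\<close>-module is a left module over the opposite ring; \<open>a \<odot>\<^bsub>M\<^esub> x\<close> then
  stands for the right action \<open>x a\<close>.  All notions below are stated for left modules and apply to
  right modules through the opposite ring.\<close>

abbreviation right_module :: "('a, 'r) ring_scheme \<Rightarrow> ('a, 'b, 'm) module_scheme \<Rightarrow> bool"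
  where "right_module R M \<equiv> left_module (opposite_ring R) M"

definition regular_module :: "('a, 'r) ring_scheme \<Rightarrow> ('a, 'a) module"
  where "regular_module R =
    \<lparr>carrier = carrier R, monoid.mult = monoid.mult R, one = one R, zero = zero R, add = add R,
     smult = monoid.mult R\<rparr>"

definition left_module_hom ::
  "('a, 'r) ring_scheme \<Rightarrow> ('a, 'b, 'm) module_scheme \<Rightarrow> ('a, 'c, 'n) module_scheme \<Rightarrow> ('b \<Rightarrow> 'c) set"
  where "left_module_hom R M N =
    {f \<in> carrier M \<rightarrow> carrier N.
      (\<forall>x \<in> carrier M. \<forall>y \<in> carrier M. f (x \<oplus>\<^bsub>M\<^esub> y) = f x \<oplus>\<^bsub>N\<^esub> f y) \<and>
      (\<forall>a \<in> carrier R. \<forall>x \<in> carrier M. f (a \<odot>\<^bsub>M\<^esub> x) = a \<odot>\<^bsub>N\<^esub> f x)}"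

definition isomorphic_modules ::
  "('a, 'r) ring_scheme \<Rightarrow> ('a, 'b, 'm) module_scheme \<Rightarrow> ('a, 'c, 'n) module_scheme \<Rightarrow> bool"
  where "isomorphic_modules R M N \<longleftrightarrow>
    (\<exists>f \<in> left_module_hom R M N. bij_betw f (carrier M) (carrier N))"

definition simple_module :: "('a, 'r) ring_scheme \<Rightarrow> ('a, 'b, 'm) module_scheme \<Rightarrow> bool"
  where "simple_module R M \<longleftrightarrow> left_module R M \<and> carrier M \<noteq> {\<zero>\<^bsub>M\<^esub>} \<and>
    (\<forall>H. Module.submodule H R M \<longrightarrow> H = {\<zero>\<^bsub>M\<^esub>} \<or> H = carrier M)"

text \<open>Every simple left \<open>R\<close>-module is \<open>R x\<close> for any nonzero element \<open>x\<close>, so it has at most as many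
  elements as \<open>R\<close>.  Hence a quantifier over simple modules may range over the modules whose elements
  have the type of the elements of \<open>R\<close>.\<close>

lemma ex_isomorphic_simple_module:
  fixes R :: "('a, 'r) ring_scheme" and M :: "('a, 'b, 'm) module_scheme"
  assumes "simple_module R M"
  shows "\<exists>S :: ('a, 'a) module. simple_module R S \<and> isomorphic_modules R S M"
proof -
  interpret left_module R M
    using assms by (simp add: simple_module_def)
  have simp_M: "H = {\<zero>\<^bsub>M\<^esub>} \<or> H = carrier M" if "Module.submodule H R M" for H
    using that assms by (simp add: simple_module_def)
  obtain x where x: "x \<in> carrier M" "x \<noteq> \<zero>\<^bsub>M\<^esub>"
    using assms M.zero_closed by (auto simp: simple_module_def)
  define H where "H = (\<lambda>a. a \<odot>\<^bsub>M\<^esub> x) ` carrier R"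
  have sub: "Module.submodule H R M"
  proof -
    have z: "\<zero>\<^bsub>R\<^esub> \<odot>\<^bsub>M\<^esub> x = \<zero>\<^bsub>M\<^esub>"
      by (metis M.add.r_cancel_one' R.r_zero R.zero_closed smult_closed smult_l_distr x(1))
    have inv: "\<ominus>\<^bsub>M\<^esub> (a \<odot>\<^bsub>M\<^esub> x) = (\<ominus>\<^bsub>R\<^esub> a) \<odot>\<^bsub>M\<^esub> x" if "a \<in> carrier R" for a
      using that x z
      by (metis M.minus_equality R.a_inv_closed R.l_neg smult_closed smult_l_distr)
    have "subgroup H (add_monoid M)"
    proof (rule M.add.subgroupI)
      show "H \<subseteq> carrier M" "H \<noteq> {}"
        using x by (auto simp: H_def smult_closed)
      show "\<ominus>\<^bsub>M\<^esub> u \<in> H" if "u \<in> H" for u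
        using that inv by (auto simp: H_def)
      show "u \<oplus>\<^bsub>M\<^esub> v \<in> H" if "u \<in> H" "v \<in> H" for u v
        using that x by (auto simp: H_def smult_l_distr[symmetric])
    qed
    moreover have "a \<odot>\<^bsub>M\<^esub> u \<in> H" if "a \<in> carrier R" "u \<in> H" for a u
      using that x by (auto simp: H_def smult_assoc[symmetric])
    ultimately show ?thesis
      by (simp add: Module.submodule_def submodule_axioms_def)
  qed
  have "x \<in> H"
    unfolding H_def using x smult_one by (metis R.one_closed image_eqI)
  then have carrier_M: "H = carrier M"
    using simp_M[OF sub] x by auto
  define g where "g = inv_into (carrier R) (\<lambda>a. a \<odot>\<^bsub>M\<^esub> x)"
  define f where "f = (\<lambda>a. a \<odot>\<^bsub>M\<^esub> x)"
  have fg [simp]: "f (g u) = u" if "u \<in> carrier M" for u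
    using that carrier_M unfolding H_def f_def g_def
    by (metis (no_types, lifting) f_inv_into_f)
  define S :: "('a, 'a) module" where "S =
    \<lparr>carrier = g ` carrier M, monoid.mult = undefined, one = undefined, zero = g \<zero>\<^bsub>M\<^esub>,
     add = (\<lambda>u v. g (f u \<oplus>\<^bsub>M\<^esub> f v)), smult = (\<lambda>a u. g (a \<odot>\<^bsub>M\<^esub> f u))\<rparr>"
  have S_simps [simp]: "carrier S = g ` carrier M" "\<zero>\<^bsub>S\<^esub> = g \<zero>\<^bsub>M\<^esub>"
    "u \<oplus>\<^bsub>S\<^esub> v = g (f u \<oplus>\<^bsub>M\<^esub> f v)" "a \<odot>\<^bsub>S\<^esub> u = g (a \<odot>\<^bsub>M\<^esub> f u)" for a u v
    by (simp_all add: S_def)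
  have "abelian_group S"
  proof (rule abelian_groupI)
    fix u assume "u \<in> carrier S"
    then obtain m where m: "m \<in> carrier M" "u = g m" by auto
    then have "g (\<ominus>\<^bsub>M\<^esub> m) \<in> carrier S" "g (\<ominus>\<^bsub>M\<^esub> m) \<oplus>\<^bsub>S\<^esub> u = \<zero>\<^bsub>S\<^esub>"
      by (auto simp: M.l_neg)
    then show "\<exists>y \<in> carrier S. y \<oplus>\<^bsub>S\<^esub> u = \<zero>\<^bsub>S\<^esub>" by blast
  qed (auto simp: M.a_ac)
  then have left_S: "left_module R S"
    using R.ring_axioms
    by (auto simp: left_module_def left_module_axioms_def smult_closed smult_l_distr
        smult_r_distr smult_assoc smult_one)
  then interpret S: left_module R S .
  have inv_f: "f (\<ominus>\<^bsub>S\<^esub> u) = \<ominus>\<^bsub>M\<^esub> f u" if "u \<in> carrier S" for u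
  proof -
    from that obtain m where m: "m \<in> carrier M" "u = g m" by auto
    have "\<ominus>\<^bsub>S\<^esub> u = g (\<ominus>\<^bsub>M\<^esub> m)"
      using m by (intro S.M.minus_equality) (auto simp: M.l_neg)
    then show ?thesis using m by simp
  qed
  have "N = {\<zero>\<^bsub>S\<^esub>} \<or> N = carrier S" if N: "Module.submodule N R S" for N
  proof -
    interpret N: Module.submodule N R S by (fact N)
    have N_sub: "N \<subseteq> g ` carrier M" using N.subset by simp
    have gf: "g (f u) = u" and fN: "f u \<in> carrier M" if u: "u \<in> N" for u
    proof -
      obtain m where "m \<in> carrier M" "u = g m" using u N_sub by blast
      then show "g (f u) = u" "f u \<in> carrier M" by (simp_all only: fg)
    qed
    have "subgroup (f ` N) (add_monoid M)"
    proof (rule M.add.subgroupI)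
      show "f ` N \<subseteq> carrier M" using fN by blast
      show "f ` N \<noteq> {}" using N.one_closed by blast
      show "\<ominus>\<^bsub>M\<^esub> y \<in> f ` N" if "y \<in> f ` N" for y
      proof -
        from that obtain u where u: "u \<in> N" "y = f u" by blast
        have "\<ominus>\<^bsub>S\<^esub> u \<in> N" using N.m_inv_closed[OF u(1)] by (simp add: a_inv_def)
        moreover have "u \<in> carrier S" using u(1) N_sub by (auto simp only: S_simps)
        ultimately show ?thesis
          using inv_f[of u] u(2) by (metis image_eqI)
      qed
      show "y \<oplus>\<^bsub>M\<^esub> z \<in> f ` N" if yz: "y \<in> f ` N" "z \<in> f ` N" for y z
      proof -
        from yz obtain u v where u: "u \<in> N" "y = f u" "v \<in> N" "z = f v" by blast
        have "u \<oplus>\<^bsub>S\<^esub> v \<in> N" using N.m_closed[OF u(1,3)] by simp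
        moreover have "f (u \<oplus>\<^bsub>S\<^esub> v) = y \<oplus>\<^bsub>M\<^esub> z" using u(2,4) fN[OF u(1)] fN[OF u(3)] by simp
        ultimately show ?thesis using imageI[of "u \<oplus>\<^bsub>S\<^esub> v" N f] by (simp only:)
      qed
    qed
    moreover have "a \<odot>\<^bsub>M\<^esub> y \<in> f ` N" if "a \<in> carrier R" "y \<in> f ` N" for a y
    proof -
      from that obtain u where u: "u \<in> N" "y = f u" by blast
      have "a \<odot>\<^bsub>S\<^esub> u \<in> N" using that(1) u(1) by (rule N.smult_closed)
      moreover have "f (a \<odot>\<^bsub>S\<^esub> u) = a \<odot>\<^bsub>M\<^esub> y"
        using u(2) fN[OF u(1)] that(1) by (simp add: smult_closed)
      ultimately show ?thesis using imageI[of "a \<odot>\<^bsub>S\<^esub> u" N f] by (simp only:)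
    qed
    ultimately have "Module.submodule (f ` N) R M"
      by (simp add: Module.submodule_def submodule_axioms_def)
    then have "f ` N = {\<zero>\<^bsub>M\<^esub>} \<or> f ` N = carrier M" by (rule simp_M)
    moreover have "N = g ` f ` N" using gf by force
    ultimately show ?thesis by auto
  qed
  moreover have "carrier S \<noteq> {\<zero>\<^bsub>S\<^esub>}"
  proof
    assume "carrier S = {\<zero>\<^bsub>S\<^esub>}"
    then have "g x = g \<zero>\<^bsub>M\<^esub>" using x by auto
    then show False using fg x by (metis M.zero_closed)
  qed
  ultimately have "simple_module R S"
    using left_S by (simp add: simple_module_def)
  moreover have "bij_betw f (carrier S) (carrier M)"
    by (rule bij_betwI[where g = g]) auto
  moreover have "f \<in> left_module_hom R S M"
    by (auto simp: left_module_hom_def smult_closed)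
  ultimately show ?thesis
    unfolding isomorphic_modules_def by blast
qed

text \<open>For a left \<open>R\<close>-module \<open>M\<close>, this is \<open>Hom\<^sub>R(M, R)\<close> with the right action
  \<open>(f a)(x) = f(x) a\<close>, i.e. a left module over \<open>opposite_ring R\<close>.  For a right \<open>R\<close>-module \<open>N\<close>,
  \<open>dual_module (opposite_ring R) N\<close> is \<open>Hom\<^sub>R(N, R)\<close> with the left action \<open>(a f)(x) = a f(x)\<close>.
  Homomorphisms are made \<open>undefined\<close> outside the carrier so that equality of functions is
  equality of homomorphisms.  The ring fields \<open>mult\<close> and \<open>one\<close> of a module record are
  meaningless here.\<close>

definition dual_module ::
  "('a, 'r) ring_scheme \<Rightarrow> ('a, 'b, 'm) module_scheme \<Rightarrow> ('a, 'b \<Rightarrow> 'a) module"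
  where "dual_module R M =
    \<lparr>carrier = left_module_hom R M (regular_module R) \<inter> extensional (carrier M),
     monoid.mult = undefined, one = undefined,
     zero = (\<lambda>x \<in> carrier M. \<zero>\<^bsub>R\<^esub>),
     add = (\<lambda>f g. \<lambda>x \<in> carrier M. f x \<oplus>\<^bsub>R\<^esub> g x),
     smult = (\<lambda>a f. \<lambda>x \<in> carrier M. f x \<otimes>\<^bsub>R\<^esub> a)\<rparr>"

lemma dual_module_is_right_module:
  assumes "left_module R M"
  shows "right_module R (dual_module R M)"
proof -
  interpret left_module R M by (fact assms)
  have hom: "f x \<in> carrier R" if "f \<in> carrier (dual_module R M)" "x \<in> carrier M" for f x
    using that by (auto simp: dual_module_def left_module_hom_def regular_module_def)
  have add: "f (x \<oplus>\<^bsub>M\<^esub> y) = f x \<oplus>\<^bsub>R\<^esub> f y"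
    if "f \<in> carrier (dual_module R M)" "x \<in> carrier M" "y \<in> carrier M" for f x y
    using that by (auto simp: dual_module_def left_module_hom_def regular_module_def)
  have lin: "f (a \<odot>\<^bsub>M\<^esub> x) = a \<otimes>\<^bsub>R\<^esub> f x"
    if "f \<in> carrier (dual_module R M)" "a \<in> carrier R" "x \<in> carrier M" for f a x
    using that by (auto simp: dual_module_def left_module_hom_def regular_module_def)
  have ext: "f \<in> extensional (carrier M)" if "f \<in> carrier (dual_module R M)" for f
    using that by (auto simp: dual_module_def)
  have memI: "f \<in> carrier (dual_module R M)"
    if "\<And>x. x \<in> carrier M \<Longrightarrow> f x \<in> carrier R"
      "\<And>x y. x \<in> carrier M \<Longrightarrow> y \<in> carrier M \<Longrightarrow> f (x \<oplus>\<^bsub>M\<^esub> y) = f x \<oplus>\<^bsub>R\<^esub> f y"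
      "\<And>a x. a \<in> carrier R \<Longrightarrow> x \<in> carrier M \<Longrightarrow> f (a \<odot>\<^bsub>M\<^esub> x) = a \<otimes>\<^bsub>R\<^esub> f x"
      "f \<in> extensional (carrier M)" for f
    using that by (auto simp: dual_module_def left_module_hom_def regular_module_def)
  have plus: "f \<oplus>\<^bsub>dual_module R M\<^esub> g = (\<lambda>x \<in> carrier M. f x \<oplus>\<^bsub>R\<^esub> g x)" for f g
    by (simp add: dual_module_def)
  have zero: "\<zero>\<^bsub>dual_module R M\<^esub> = (\<lambda>x \<in> carrier M. \<zero>\<^bsub>R\<^esub>)"
    by (simp add: dual_module_def)
  have act: "a \<odot>\<^bsub>dual_module R M\<^esub> f = (\<lambda>x \<in> carrier M. f x \<otimes>\<^bsub>R\<^esub> a)" for a f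
    by (simp add: dual_module_def)
  have plus_closed: "f \<oplus>\<^bsub>dual_module R M\<^esub> g \<in> carrier (dual_module R M)"
    if "f \<in> carrier (dual_module R M)" "g \<in> carrier (dual_module R M)" for f g
    using that unfolding plus
    by (intro memI) (auto simp: hom add lin smult_closed R.a_ac R.r_distr)
  have group: "abelian_group (dual_module R M)"
  proof (rule abelian_groupI)
    show "\<zero>\<^bsub>dual_module R M\<^esub> \<in> carrier (dual_module R M)"
      unfolding zero by (intro memI) (auto simp: smult_closed)
    fix f assume f: "f \<in> carrier (dual_module R M)"
    show "\<zero>\<^bsub>dual_module R M\<^esub> \<oplus>\<^bsub>dual_module R M\<^esub> f = f"
      unfolding zero plus
      by (rule extensionalityI[OF _ ext[OF f]]) (auto simp: hom[OF f])
    have "(\<lambda>x \<in> carrier M. \<ominus>\<^bsub>R\<^esub> f x) \<in> carrier (dual_module R M)"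
      using f by (intro memI) (auto simp: hom add lin smult_closed R.minus_add R.r_minus)
    moreover have "(\<lambda>x \<in> carrier M. \<ominus>\<^bsub>R\<^esub> f x) \<oplus>\<^bsub>dual_module R M\<^esub> f = \<zero>\<^bsub>dual_module R M\<^esub>"
      unfolding zero plus by (rule restrict_ext) (simp add: hom[OF f] R.l_neg)
    ultimately show "\<exists>g \<in> carrier (dual_module R M).
        g \<oplus>\<^bsub>dual_module R M\<^esub> f = \<zero>\<^bsub>dual_module R M\<^esub>" by blast
  qed (auto simp: plus_closed, auto simp: plus hom R.a_ac intro!: restrict_ext)
  have "ring (opposite_ring R)"
  proof (rule ringI)
    show "abelian_group (opposite_ring R)"
      using R.abelian_group_axioms
      by (simp add: opposite_ring_def abelian_group_def abelian_group_axioms_def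
          abelian_monoid_def)
    show "monoid (opposite_ring R)"
      by (unfold_locales) (auto simp: opposite_ring_def R.m_assoc)
  qed (auto simp: opposite_ring_def R.l_distr R.r_distr)
  moreover have "left_module_axioms (opposite_ring R) (dual_module R M)"
  proof (rule left_module_axioms.intro)
    fix a f assume "a \<in> carrier (opposite_ring R)" "f \<in> carrier (dual_module R M)"
    then show "a \<odot>\<^bsub>dual_module R M\<^esub> f \<in> carrier (dual_module R M)"
      unfolding act
      by (intro memI) (auto simp: opposite_ring_def hom add lin smult_closed R.l_distr R.m_assoc)
  next
    fix f assume f: "f \<in> carrier (dual_module R M)"
    show "\<one>\<^bsub>opposite_ring R\<^esub> \<odot>\<^bsub>dual_module R M\<^esub> f = f"
      unfolding act
      by (rule extensionalityI[OF _ ext[OF f]]) (auto simp: opposite_ring_def hom[OF f])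
  qed (auto simp: opposite_ring_def act plus hom smult_closed R.l_distr R.r_distr R.m_assoc
      intro!: restrict_ext)
  ultimately show ?thesis
    using group by (simp add: left_module_def)
qed

abbreviation bidual_module ::
  "('a, 'r) ring_scheme \<Rightarrow> ('a, 'b, 'm) module_scheme \<Rightarrow> ('a, ('b \<Rightarrow> 'a) \<Rightarrow> 'a) module"
  where "bidual_module R M \<equiv> dual_module (opposite_ring R) (dual_module R M)"

definition evaluation_map ::
  "('a, 'r) ring_scheme \<Rightarrow> ('a, 'b, 'm) module_scheme \<Rightarrow> 'b \<Rightarrow> ('b \<Rightarrow> 'a) \<Rightarrow> 'a"
  where "evaluation_map R M = (\<lambda>m \<in> carrier M. \<lambda>f \<in> carrier (dual_module R M). f m)"

definition reflexive_module :: "('a, 'r) ring_scheme \<Rightarrow> ('a, 'b, 'm) module_scheme \<Rightarrow> bool"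
  where "reflexive_module R M \<longleftrightarrow> left_module R M \<and>
    bij_betw (evaluation_map R M) (carrier M) (carrier (bidual_module R M))"

text \<open>Injectivity with respect to all monomorphisms between modules whose elements have type
  \<open>'x\<close>.  HOL cannot quantify over types inside a formula: to express injectivity, \<open>'x\<close> has to be
  left as a free type variable of the theorem.\<close>

definition injective_module ::
  "'x itself \<Rightarrow> ('a, 'r) ring_scheme \<Rightarrow> ('a, 'b, 'q) module_scheme \<Rightarrow> bool"
  where "injective_module TYPE('x) R Q \<longleftrightarrow> left_module R Q \<and>
    (\<forall>M :: ('a, 'x) module. \<forall>N :: ('a, 'x) module.
      left_module R M \<and> left_module R N \<longrightarrow>
      (\<forall>i \<in> left_module_hom R M N. \<forall>g \<in> left_module_hom R M Q. inj_on i (carrier M) \<longrightarrow>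
        (\<exists>h \<in> left_module_hom R N Q. \<forall>x \<in> carrier M. h (i x) = g x)))"

abbreviation self_injective :: "'x itself \<Rightarrow> ('a, 'r) ring_scheme \<Rightarrow> bool"
  where "self_injective TYPE('x) R \<equiv> injective_module TYPE('x) R (regular_module R)"

text \<open>The record \<open>A\<close> carries both the ring structure and, through \<open>smult\<close>, the action of \<open>K\<close>.
  (The locale \<^locale>\<open>algebra\<close> of the library requires \<open>A\<close> to be commutative.)\<close>

locale fin_dim_algebra = vectorspace K A + A?: ring A
  for K :: "('k, 'l) ring_scheme" and A :: "('k, 'a, 'm) module_scheme" +
  assumes smult_mult_left:
      "\<lbrakk>c \<in> carrier K; x \<in> carrier A; y \<in> carrier A\<rbrakk> \<Longrightarrow>
        (c \<odot>\<^bsub>A\<^esub> x) \<otimes>\<^bsub>A\<^esub> y = c \<odot>\<^bsub>A\<^esub> (x \<otimes>\<^bsub>A\<^esub> y)"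
    and smult_mult_right:
      "\<lbrakk>c \<in> carrier K; x \<in> carrier A; y \<in> carrier A\<rbrakk> \<Longrightarrow>
        x \<otimes>\<^bsub>A\<^esub> (c \<odot>\<^bsub>A\<^esub> y) = c \<odot>\<^bsub>A\<^esub> (x \<otimes>\<^bsub>A\<^esub> y)"
    and finite_dimensional: "vectorspace.fin_dim K A"

end

theory Submission
  imports Defs
begin

text \<open>Every simple left module is \<open>A / m\<close> for a maximal left ideal \<open>m\<close>, and \<open>f \<mapsto> f(1 + m)\<close>
identifies its dual with the right annihilator \<open>rann m\<close> of \<open>m\<close>.  Everything can therefore be said
inside \<open>A\<close>.  Reflexivity of \<open>A / m\<close> means that \<open>m\<close> is the left annihilator of \<open>rann m\<close> and
that every homomorphism from the right ideal \<open>rann m\<close> to \<open>A\<close> is left multiplication by an element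
of \<open>A\<close>.  The dual of \<open>A / m\<close> is simple iff \<open>rann m\<close> is a minimal right ideal.  The isomorphism
class of \<open>A / m\<close> is determined by its annihilator \<open>core m\<close>, and the annihilators of the simple left
modules, like those of the simple right modules, are the maximal two-sided ideals.  There are
finitely many of these, so there are equally many simple left and simple right modules.

\<^emph>\<open>The dual of \<open>T\<close> is simple.\<close>  Let \<open>S\<close> range over the simple left modules other than \<open>T\<close>.  Their
duals are simple by assumption and pairwise non-isomorphic by reflexivity, so exactly one simple right module \<open>N\<close> is not of the form
\<open>S\<^sup>*\<close>.  Let \<open>U = T\<^sup>*\<close>.  A simple submodule of \<open>U\<close> isomorphic to \<open>S\<^sup>*\<close> would give a nonzero map
\<open>T \<rightarrow> S\<^sup>*\<^sup>* = S\<close>, and a simple quotient of \<open>U\<close> isomorphic to \<open>S\<^sup>*\<close> would give a nonzero map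
\<open>S = S\<^sup>*\<^sup>* \<rightarrow> U\<^sup>* = T\<close>.  Neither exists, so both a simple quotient \<open>U / V\<close> and a simple submodule of
\<open>U\<close> are isomorphic to \<open>N\<close>, and there is a nonzero endomorphism of \<open>U\<close> that kills \<open>V\<close>.  Its
transpose is a nonzero endomorphism of the simple module \<open>U\<^sup>* = T\<close>, hence surjective, so every element
of \<open>T\<close>, regarded as a functional on \<open>U\<close>, kills \<open>V\<close>.  Therefore \<open>V = 0\<close> and \<open>U\<close> is simple
(\<open>rann_minimal_if_others_minimal\<close>).

\<^emph>\<open>\<open>A\<close> is self-injective.\<close>  Now the dual of every simple left module is simple, and by the bijection between left
and right simple modules the duals of simple right modules are simple too (\<open>lann_minimal\<close>).
Therefore taking annihilators turns a simple factor \<open>J / I\<close> of one-sided ideals into a factor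
\<open>rann I / rann J\<close> that is simple or zero.  Applied to both sides, this shows that \<open>A\<close> has
the same length as a left and as a right module, and then that none of these factors is zero
(\<open>rann_covers_neq\<close>).  This says that every homomorphism \<open>J / I \<rightarrow> A\<close> is a right multiplication; induction
along a composition series extends this to all left ideals, and Baer's criterion finishes the proof.\<close>

section \<open>One-sided ideals\<close>

lemma opposite_ring_simps [simp]:
  "carrier (opposite_ring R) = carrier R"
  "\<zero>\<^bsub>opposite_ring R\<^esub> = \<zero>\<^bsub>R\<^esub>"
  "\<one>\<^bsub>opposite_ring R\<^esub> = \<one>\<^bsub>R\<^esub>"
  "x \<oplus>\<^bsub>opposite_ring R\<^esub> y = x \<oplus>\<^bsub>R\<^esub> y"
  "x \<otimes>\<^bsub>opposite_ring R\<^esub> y = y \<otimes>\<^bsub>R\<^esub> x"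
  "\<ominus>\<^bsub>opposite_ring R\<^esub> x = \<ominus>\<^bsub>R\<^esub> x"
  "x \<ominus>\<^bsub>opposite_ring R\<^esub> y = x \<ominus>\<^bsub>R\<^esub> y"
  by (simp_all add: opposite_ring_def a_inv_def a_minus_def)

lemma (in ring) ring_opposite_ring: "ring (opposite_ring R)"
proof (rule ringI)
  show "abelian_group (opposite_ring R)"
    by (rule abelian_groupI) (auto simp: a_ac intro: l_neg)
  show "monoid (opposite_ring R)"
    by unfold_locales (auto simp: m_assoc)
qed (auto simp: l_distr r_distr)

text \<open>Closure under negation is a consequence, as \<open>- x = (- 1) x\<close>.  Right ideals are left ideals of the opposite
ring, so that one-sided facts are proved only once.\<close>

definition left_ideal :: "('a, 'r) ring_scheme \<Rightarrow> 'a set \<Rightarrow> bool" where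
  "left_ideal R I \<longleftrightarrow> I \<subseteq> carrier R \<and> \<zero>\<^bsub>R\<^esub> \<in> I \<and> (\<forall>x\<in>I. \<forall>y\<in>I. x \<oplus>\<^bsub>R\<^esub> y \<in> I)
     \<and> (\<forall>a\<in>carrier R. \<forall>x\<in>I. a \<otimes>\<^bsub>R\<^esub> x \<in> I)"

abbreviation right_ideal :: "('a, 'r) ring_scheme \<Rightarrow> 'a set \<Rightarrow> bool" where
  "right_ideal R \<equiv> left_ideal (opposite_ring R)"

text \<open>The factor module \<open>J / I\<close> is simple.\<close>

definition covers :: "('a, 'r) ring_scheme \<Rightarrow> 'a set \<Rightarrow> 'a set \<Rightarrow> bool" where
  "covers R I J \<longleftrightarrow> left_ideal R I \<and> left_ideal R J \<and> I \<subset> J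
     \<and> (\<forall>Z. left_ideal R Z \<longrightarrow> I \<subseteq> Z \<longrightarrow> Z \<subseteq> J \<longrightarrow> Z = I \<or> Z = J)"

abbreviation max_left_ideal :: "('a, 'r) ring_scheme \<Rightarrow> 'a set \<Rightarrow> bool" where
  "max_left_ideal R m \<equiv> covers R m (carrier R)"

abbreviation min_left_ideal :: "('a, 'r) ring_scheme \<Rightarrow> 'a set \<Rightarrow> bool" where
  "min_left_ideal R N \<equiv> covers R {\<zero>\<^bsub>R\<^esub>} N"

abbreviation max_right_ideal :: "('a, 'r) ring_scheme \<Rightarrow> 'a set \<Rightarrow> bool" where
  "max_right_ideal R \<equiv> max_left_ideal (opposite_ring R)"

abbreviation min_right_ideal :: "('a, 'r) ring_scheme \<Rightarrow> 'a set \<Rightarrow> bool" where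
  "min_right_ideal R \<equiv> min_left_ideal (opposite_ring R)"

text \<open>If \<open>u\<close> represents an element of \<open>R / I\<close>, or of \<open>J / I\<close> for a larger left ideal \<open>J\<close>, this is the
annihilator of that element.\<close>

definition colon :: "('a, 'r) ring_scheme \<Rightarrow> 'a set \<Rightarrow> 'a \<Rightarrow> 'a set" where
  "colon R I u = {a \<in> carrier R. a \<otimes>\<^bsub>R\<^esub> u \<in> I}"

text \<open>The annihilator of the module \<open>R / I\<close>, which is the largest two-sided ideal contained in the left ideal
\<open>I\<close>.\<close>

definition core :: "('a, 'r) ring_scheme \<Rightarrow> 'a set \<Rightarrow> 'a set" where
  "core R I = {a \<in> carrier R. \<forall>b\<in>carrier R. a \<otimes>\<^bsub>R\<^esub> b \<in> I}"

text \<open>The right annihilator of \<open>I\<close>; for a left ideal \<open>I\<close> it is the dual of \<open>R / I\<close>.  The left annihilator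
is \<open>rann (opposite_ring R)\<close>.\<close>

definition rann :: "('a, 'r) ring_scheme \<Rightarrow> 'a set \<Rightarrow> 'a set" where
  "rann R I = {a \<in> carrier R. \<forall>x\<in>I. x \<otimes>\<^bsub>R\<^esub> a = \<zero>\<^bsub>R\<^esub>}"

context ring
begin

lemma left_idealD:
  assumes "left_ideal R I"
  shows "x \<in> I \<Longrightarrow> x \<in> carrier R" "\<zero> \<in> I" "x \<in> I \<Longrightarrow> y \<in> I \<Longrightarrow> x \<oplus> y \<in> I"
    "a \<in> carrier R \<Longrightarrow> x \<in> I \<Longrightarrow> a \<otimes> x \<in> I"
  using assms by (auto simp: left_ideal_def)

lemma left_ideal_uminus: "left_ideal R I \<Longrightarrow> x \<in> I \<Longrightarrow> \<ominus> x \<in> I"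
  using left_idealD(1)[of I x] left_idealD(4)[of I "\<ominus> \<one>" x] by (simp add: l_minus)

lemma left_ideal_minus: "left_ideal R I \<Longrightarrow> x \<in> I \<Longrightarrow> y \<in> I \<Longrightarrow> x \<ominus> y \<in> I"
  by (simp add: a_minus_def left_ideal_uminus left_idealD(3))

lemma add_minus_cancel: "x \<in> carrier R \<Longrightarrow> y \<in> carrier R \<Longrightarrow> (x \<ominus> y) \<oplus> y = x"
  by (simp add: a_minus_def a_assoc l_neg)

lemma minus_minus_cancel: "x \<in> carrier R \<Longrightarrow> y \<in> carrier R \<Longrightarrow> x \<ominus> (x \<ominus> y) = y"
  by (simp add: a_minus_def minus_add a_assoc[symmetric] r_neg)

lemma left_ideal_minus_iff:
  assumes "left_ideal R I" "x \<in> carrier R" "y \<in> carrier R" "x \<ominus> y \<in> I"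
  shows "x \<in> I \<longleftrightarrow> y \<in> I"
  by (metis assms add_minus_cancel minus_minus_cancel left_ideal_minus left_idealD(3))

lemma l_distr_minus:
  "x \<in> carrier R \<Longrightarrow> y \<in> carrier R \<Longrightarrow> z \<in> carrier R \<Longrightarrow> (x \<ominus> y) \<otimes> z = x \<otimes> z \<ominus> y \<otimes> z"
  by (simp add: a_minus_def l_distr l_minus)

lemma r_distr_minus:
  "x \<in> carrier R \<Longrightarrow> y \<in> carrier R \<Longrightarrow> z \<in> carrier R \<Longrightarrow> z \<otimes> (x \<ominus> y) = z \<otimes> x \<ominus> z \<otimes> y"
  by (simp add: a_minus_def r_distr r_minus)

lemma left_ideal_carrier: "left_ideal R (carrier R)"
  by (auto simp: left_ideal_def)

lemma left_ideal_zero: "left_ideal R {\<zero>}"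
  by (auto simp: left_ideal_def)

lemma left_ideal_Int: "left_ideal R I \<Longrightarrow> left_ideal R J \<Longrightarrow> left_ideal R (I \<inter> J)"
  by (auto simp: left_ideal_def)

lemma left_ideal_eq_carrier: "left_ideal R I \<Longrightarrow> \<one> \<in> I \<Longrightarrow> I = carrier R"
  using left_idealD(1,4)[of I] by (metis r_one subset_antisym subsetI)

lemma left_ideal_colon: "left_ideal R I \<Longrightarrow> u \<in> carrier R \<Longrightarrow> left_ideal R (colon R I u)"
  by (auto simp: left_ideal_def colon_def l_distr m_assoc)

lemma left_ideal_sum:
  assumes "left_ideal R I" "left_ideal R J"
  shows "left_ideal R {x \<oplus> y | x y. x \<in> I \<and> y \<in> J}"
  unfolding left_ideal_def
proof (intro conjI ballI)
  note c = left_idealD(1)[OF assms(1)] left_idealD(1)[OF assms(2)]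
  show "{x \<oplus> y |x y. x \<in> I \<and> y \<in> J} \<subseteq> carrier R"
    using c by auto
  show "\<zero> \<in> {x \<oplus> y |x y. x \<in> I \<and> y \<in> J}"
    using assms[THEN left_idealD(2)] r_zero[OF zero_closed, symmetric] by blast
  fix p assume "p \<in> {x \<oplus> y |x y. x \<in> I \<and> y \<in> J}"
  then obtain x y where p: "p = x \<oplus> y" "x \<in> I" "y \<in> J" by blast
  { fix q assume "q \<in> {x \<oplus> y |x y. x \<in> I \<and> y \<in> J}"
    then obtain x' y' where q: "q = x' \<oplus> y'" "x' \<in> I" "y' \<in> J" by blast
    have "p \<oplus> q = (x \<oplus> x') \<oplus> (y \<oplus> y')"
      using p q c by (simp add: a_ac)
    then show "p \<oplus> q \<in> {x \<oplus> y |x y. x \<in> I \<and> y \<in> J}"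
      using p q assms by (blast intro: left_idealD(3)) }
  fix a assume a: "a \<in> carrier R"
  then have "a \<otimes> p = a \<otimes> x \<oplus> a \<otimes> y"
    using p c by (simp add: r_distr)
  then show "a \<otimes> p \<in> {x \<oplus> y |x y. x \<in> I \<and> y \<in> J}"
    using p assms a by (blast intro: left_idealD(4))
qed

lemma left_ideal_principal: "u \<in> carrier R \<Longrightarrow> left_ideal R ((\<lambda>a. a \<otimes> u) ` carrier R)"
  unfolding left_ideal_def
proof (intro conjI ballI)
  assume u: "u \<in> carrier R"
  show "(\<lambda>a. a \<otimes> u) ` carrier R \<subseteq> carrier R" using u by auto
  show "\<zero> \<in> (\<lambda>a. a \<otimes> u) ` carrier R" using u by (metis image_eqI l_null zero_closed)
  fix p assume "p \<in> (\<lambda>a. a \<otimes> u) ` carrier R"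
  then obtain x where p: "p = x \<otimes> u" "x \<in> carrier R" by blast
  { fix q assume "q \<in> (\<lambda>a. a \<otimes> u) ` carrier R"
    then obtain y where q: "q = y \<otimes> u" "y \<in> carrier R" by blast
    show "p \<oplus> q \<in> (\<lambda>a. a \<otimes> u) ` carrier R"
      using p q u by (metis add.m_closed image_eqI l_distr) }
  fix a assume "a \<in> carrier R"
  then show "a \<otimes> p \<in> (\<lambda>a. a \<otimes> u) ` carrier R"
    using p u by (metis m_assoc m_closed image_eqI)
qed

lemma coversD:
  assumes "covers R I J"
  shows "left_ideal R I" "left_ideal R J" "I \<subset> J"
    "left_ideal R Z \<Longrightarrow> I \<subseteq> Z \<Longrightarrow> Z \<subseteq> J \<Longrightarrow> Z = I \<or> Z = J"
  using assms unfolding covers_def by blast+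

text \<open>A simple module is generated by any nonzero element, here \<open>z + I\<close>.  In this form simplicity
needs no quotient modules; \<open>coversI\<close> is the converse.\<close>

lemma covers_elem:
  assumes IJ: "covers R I J" and z: "z \<in> J" "z \<notin> I" and x: "x \<in> J"
  shows "\<exists>a\<in>carrier R. x \<ominus> a \<otimes> z \<in> I"
proof -
  note I = coversD(1)[OF IJ] and J = coversD(2)[OF IJ]
  note c = left_idealD(1)[OF I] left_idealD(1)[OF J]
  have zc: "z \<in> carrier R" using c z by blast
  let ?Z = "{p \<oplus> q | p q. p \<in> I \<and> q \<in> (\<lambda>a. a \<otimes> z) ` carrier R}"
  have Z: "left_ideal R ?Z"
    by (rule left_ideal_sum[OF I left_ideal_principal[OF zc]])
  have "\<zero> \<in> (\<lambda>a. a \<otimes> z) ` carrier R" using zc by (metis image_eqI l_null zero_closed)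
  then have "x \<in> ?Z" if "x \<in> I" for x
  proof -
    have "x = x \<oplus> \<zero>" using that c by simp
    then show ?thesis using that \<open>\<zero> \<in> _\<close> by blast
  qed
  then have "I \<subseteq> ?Z" by blast
  moreover have "?Z \<subseteq> J"
    using z coversD(3)[OF IJ] J by (auto intro!: left_idealD(3,4))
  moreover have "z \<in> ?Z"
  proof -
    have "z = \<zero> \<oplus> \<one> \<otimes> z" using zc by simp
    then show ?thesis using left_idealD(2)[OF I] by blast
  qed
  ultimately have "?Z = J" using coversD(4)[OF IJ Z] z by blast
  then obtain p a where "x = p \<oplus> a \<otimes> z" "p \<in> I" "a \<in> carrier R" using x by blast
  moreover from this have "x \<ominus> a \<otimes> z = p"
    using c zc by (simp add: a_minus_def a_assoc r_neg)
  ultimately show ?thesis by (intro bexI[of _ a]) simp_all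
qed

lemma coversI:
  assumes I: "left_ideal R I" and J: "left_ideal R J" and "I \<subset> J"
    and e: "\<And>z x. z \<in> J \<Longrightarrow> z \<notin> I \<Longrightarrow> x \<in> J \<Longrightarrow> \<exists>a\<in>carrier R. x \<ominus> a \<otimes> z \<in> I"
  shows "covers R I J"
  unfolding covers_def
proof (intro conjI allI impI)
  fix Z assume Z: "left_ideal R Z" "I \<subseteq> Z" "Z \<subseteq> J"
  show "Z = I \<or> Z = J"
  proof (cases "Z = I")
    case False
    then obtain z where z: "z \<in> Z" "z \<notin> I" using Z by blast
    have "x \<in> Z" if x: "x \<in> J" for x
    proof -
      obtain a where a: "a \<in> carrier R" "x \<ominus> a \<otimes> z \<in> I" 
        using e[OF _ z(2) x] z(1) Z(3) by blast
      have "a \<otimes> z \<in> Z" using a z left_idealD(4)[OF Z(1)] by blast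
      then show ?thesis
        using left_ideal_minus_iff[OF Z(1), of x "a \<otimes> z"] a x Z left_idealD(1)[OF J] by blast
    qed
    then show ?thesis using Z by blast
  qed auto
qed (use assms in auto)

lemma max_left_ideal_one: "max_left_ideal R m \<Longrightarrow> \<one> \<notin> m"
  using left_ideal_eq_carrier coversD(1,3) by blast

lemma max_left_ideal_eq:
  assumes "max_left_ideal R m" "left_ideal R I" "m \<subseteq> I" "\<one> \<notin> I"
  shows "I = m"
  using coversD(4)[OF assms(1,2,3)] left_idealD(1)[OF assms(2)] assms(4) by blast

text \<open>The simple module \<open>J / I\<close> is isomorphic to \<open>R / colon R I u\<close>, since it is generated by \<open>u + I\<close>.\<close>

lemma covers_colon:
  assumes IJ: "covers R I J" and u: "u \<in> J" "u \<notin> I"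
  shows "max_left_ideal R (colon R I u)"
proof (rule coversI)
  note I = coversD(1)[OF IJ] and J = coversD(2)[OF IJ]
  have uc: "u \<in> carrier R" using left_idealD(1)[OF J] u by blast
  show "left_ideal R (colon R I u)" by (rule left_ideal_colon[OF I uc])
  show "left_ideal R (carrier R)" by (rule left_ideal_carrier)
  have "\<one> \<notin> colon R I u" using u uc by (simp add: colon_def)
  then show "colon R I u \<subset> carrier R" by (auto simp: colon_def)
  fix z x assume z: "z \<in> carrier R" "z \<notin> colon R I u" and x: "x \<in> carrier R"
  have "z \<otimes> u \<in> J" "z \<otimes> u \<notin> I" "x \<otimes> u \<in> J"
    using z x u left_idealD(4)[OF J] by (auto simp: colon_def)
  then obtain a where "a \<in> carrier R" "x \<otimes> u \<ominus> a \<otimes> (z \<otimes> u) \<in> I"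
    using covers_elem[OF IJ] by blast
  then show "\<exists>a\<in>carrier R. x \<ominus> a \<otimes> z \<in> colon R I u"
    using z x uc by (intro bexI[of _ a]) (auto simp: colon_def l_distr_minus m_assoc)
qed

text \<open>A well-defined map \<open>R / m \<rightarrow> R / I\<close>, \<open>1 \<mapsto> c\<close>, from a simple module is injective unless it is zero.\<close>

lemma colon_eq_max:
  assumes m: "max_left_ideal R m" and I: "left_ideal R I" and c: "c \<in> carrier R" "c \<notin> I"
    and "\<And>a. a \<in> m \<Longrightarrow> a \<otimes> c \<in> I"
  shows "colon R I c = m"
proof (rule max_left_ideal_eq[OF m left_ideal_colon[OF I c(1)]])
  show "m \<subseteq> colon R I c"
    using assms(5) left_idealD(1)[OF coversD(1)[OF m]] by (auto simp: colon_def)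
  show "\<one> \<notin> colon R I c" using c by (simp add: colon_def)
qed

lemma core_subset: "core R I \<subseteq> I"
proof
  fix a assume "a \<in> core R I"
  then have "a \<in> carrier R" "a \<otimes> \<one> \<in> I" by (auto simp: core_def simp del: r_one)
  then show "a \<in> I" by simp
qed

lemma left_ideal_core: "left_ideal R I \<Longrightarrow> left_ideal R (core R I)"
  by (auto simp: left_ideal_def core_def l_distr m_assoc)

lemma right_ideal_core: "left_ideal R I \<Longrightarrow> right_ideal R (core R I)"
  by (auto simp: left_ideal_def core_def l_distr m_assoc)

lemma core_greatest: "left_ideal R P \<Longrightarrow> right_ideal R P \<Longrightarrow> P \<subseteq> I \<Longrightarrow> P \<subseteq> core R I"
  by (auto simp: left_ideal_def core_def)

text \<open>\<open>R / colon R I c\<close> is isomorphic to the submodule of \<open>R / I\<close> generated by \<open>c\<close>.\<close>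

lemma core_subset_core_colon: "c \<in> carrier R \<Longrightarrow> core R I \<subseteq> core R (colon R I c)"
  by (auto simp: core_def colon_def m_assoc)

lemma right_ideal_rann: "I \<subseteq> carrier R \<Longrightarrow> right_ideal R (rann R I)"
  by (auto simp: left_ideal_def rann_def r_distr m_assoc[symmetric] subset_iff)

lemma rann_antimono: "I \<subseteq> J \<Longrightarrow> rann R J \<subseteq> rann R I"
  by (auto simp: rann_def)

end

section \<open>Simple modules up to isomorphism in a ring of finite length\<close>

text \<open>A fixed function on left ideals that is strictly monotone, when there is one.  It yields both chain conditions; for a finite-dimensional algebra it comes from the dimension.\<close>

definition strict_rank :: "('a, 'r) ring_scheme \<Rightarrow> 'a set \<Rightarrow> nat" where
  "strict_rank R = (SOME d. \<forall>I J. left_ideal R I \<longrightarrow> left_ideal R J \<longrightarrow> I \<subset> J \<longrightarrow> d I < d J)"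

definition two_sided :: "('a, 'r) ring_scheme \<Rightarrow> 'a set \<Rightarrow> bool" where
  "two_sided R P \<longleftrightarrow> left_ideal R P \<and> right_ideal R P"

definition max_two_sided :: "('a, 'r) ring_scheme \<Rightarrow> 'a set \<Rightarrow> bool" where
  "max_two_sided R P \<longleftrightarrow> two_sided R P \<and> \<one>\<^bsub>R\<^esub> \<notin> P
     \<and> (\<forall>Q. two_sided R Q \<longrightarrow> \<one>\<^bsub>R\<^esub> \<notin> Q \<longrightarrow> P \<subseteq> Q \<longrightarrow> Q = P)"

lemma max_two_sidedD:
  assumes "max_two_sided R P"
  shows "two_sided R P" "\<one>\<^bsub>R\<^esub> \<notin> P"
    "two_sided R Q \<Longrightarrow> \<one>\<^bsub>R\<^esub> \<notin> Q \<Longrightarrow> P \<subseteq> Q \<Longrightarrow> Q = P"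
  using assms unfolding max_two_sided_def by blast+

lemma two_sided_opposite [simp]: "two_sided (opposite_ring R) P \<longleftrightarrow> two_sided R P"
  by (auto simp: two_sided_def)

lemma max_two_sided_opposite [simp]: "max_two_sided (opposite_ring R) P \<longleftrightarrow> max_two_sided R P"
  by (simp add: max_two_sided_def)

text \<open>If \<open>U\<close> is not contained in \<open>P\<close>, then \<open>1 = x + p\<close> with \<open>x \<in> U\<close> and \<open>p \<in> P\<close>, and every
\<open>y \<in> W\<close> is \<open>x y + p y\<close> with \<open>x y \<in> U \<inter> W\<close>.\<close>

lemma (in ring) max_two_sided_prime:
  assumes P: "max_two_sided R P" and U: "two_sided R U" and W: "two_sided R W"
    and XY: "U \<inter> W \<subseteq> P"
  shows "U \<subseteq> P \<or> W \<subseteq> P"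
proof (cases "U \<subseteq> P")
  case False
  then obtain x0 where x0: "x0 \<in> U" "x0 \<notin> P" by blast
  let ?S = "{x \<oplus> y | x y. x \<in> U \<and> y \<in> P}"
  note PD = P[unfolded max_two_sided_def two_sided_def]
  have XL: "left_ideal R U" and XR: "right_ideal R U" and YL: "left_ideal R W" and YR: "right_ideal R W"
    and PL: "left_ideal R P" and PR: "right_ideal R P"
    using U W PD by (auto simp: two_sided_def)
  have "left_ideal R ?S" by (rule left_ideal_sum[OF XL PL])
  moreover have "right_ideal R ?S"
    using ring.left_ideal_sum[OF ring_opposite_ring XR PR] by simp
  ultimately have S: "two_sided R ?S" by (simp add: two_sided_def)
  have "y \<in> ?S" if y: "y \<in> P" for y
  proof -
    have "y = \<zero> \<oplus> y" using left_idealD(1)[OF PL y] by simp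
    then show ?thesis using left_idealD(2)[OF XL] y by blast
  qed
  then have sub: "P \<subseteq> ?S" by blast
  have "x0 = x0 \<oplus> \<zero>" using left_idealD(1)[OF XL x0(1)] by simp
  then have "x0 \<in> ?S" using left_idealD(2)[OF PL] x0(1) by blast
  then have "?S \<noteq> P" using x0(2) by blast
  then have "\<one> \<in> ?S" using P S sub unfolding max_two_sided_def by blast
  then obtain x p where xp: "\<one> = x \<oplus> p" "x \<in> U" "p \<in> P" by blast
  have "y \<in> P" if y: "y \<in> W" for y
  proof -
    have c: "x \<in> carrier R" "p \<in> carrier R" "y \<in> carrier R"
      using xp y left_idealD(1)[OF XL] left_idealD(1)[OF PL] left_idealD(1)[OF YL] by auto
    have "x \<otimes> y \<in> U"
      using ring.left_idealD(4)[OF ring_opposite_ring XR, of y x] c xp(2) by simp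
    moreover have "x \<otimes> y \<in> W" using left_idealD(4)[OF YL] c y by simp
    ultimately have 1: "x \<otimes> y \<in> P" using XY by blast
    have 2: "p \<otimes> y \<in> P"
      using ring.left_idealD(4)[OF ring_opposite_ring PR, of y p] c xp(3) by simp
    have "y = x \<otimes> y \<oplus> p \<otimes> y" using c xp(1) by (metis l_distr l_one)
    then show ?thesis using left_idealD(3)[OF PL 1 2] by simp
  qed
  then show ?thesis by blast
qed simp

text \<open>Equivalent to finite length of \<open>R\<close> as a left module over itself.\<close>

locale left_finite_length = ring R for R (structure) +
  assumes ex_strict_rank:
    "\<exists>d :: 'a set \<Rightarrow> nat. \<forall>I J. left_ideal R I \<longrightarrow> left_ideal R J \<longrightarrow> I \<subset> J \<longrightarrow> d I < d J"
begin

lemma strict_rank_less: "left_ideal R I \<Longrightarrow> left_ideal R J \<Longrightarrow> I \<subset> J \<Longrightarrow> strict_rank R I < strict_rank R J"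
  using someI_ex[OF ex_strict_rank] unfolding strict_rank_def by blast

lemma ex_covers_below:
  assumes "left_ideal R I" "left_ideal R U" "I \<subset> U"
  shows "\<exists>V. I \<subseteq> V \<and> covers R V U"
proof -
  have "left_ideal R I \<and> I \<subseteq> I \<and> I \<subset> U" using assms by blast
  from ex_has_least_nat[of "\<lambda>V. left_ideal R V \<and> I \<subseteq> V \<and> V \<subset> U", OF this,
      of "\<lambda>V. strict_rank R U - strict_rank R V"]
  obtain V where V: "left_ideal R V" "I \<subseteq> V" "V \<subset> U"
    and min: "\<And>W. left_ideal R W \<Longrightarrow> I \<subseteq> W \<Longrightarrow> W \<subset> U \<Longrightarrow> strict_rank R U - strict_rank R V \<le> strict_rank R U - strict_rank R W" by blast
  have "Z = V \<or> Z = U" if Z: "left_ideal R Z" "V \<subseteq> Z" "Z \<subseteq> U" for Z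
  proof (rule ccontr)
    assume "\<not> (Z = V \<or> Z = U)"
    then have "V \<subset> Z" "Z \<subset> U" using Z by auto
    then have "strict_rank R V < strict_rank R Z" "strict_rank R Z < strict_rank R U"
      using strict_rank_less V Z assms by auto
    then show False
      using min[OF Z(1) subset_trans[OF V(2) Z(2)] \<open>Z \<subset> U\<close>] by simp
  qed
  then have "covers R V U" unfolding covers_def using V assms by blast
  then show ?thesis using V by blast
qed

lemma ex_covers_above:
  assumes "left_ideal R I" "left_ideal R U" "I \<subset> U"
  shows "\<exists>V. covers R I V \<and> V \<subseteq> U"
proof -
  have "left_ideal R U \<and> I \<subset> U \<and> U \<subseteq> U" using assms by blast
  from ex_has_least_nat[of "\<lambda>V. left_ideal R V \<and> I \<subset> V \<and> V \<subseteq> U", OF this, of "strict_rank R"]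
  obtain V where V: "left_ideal R V" "I \<subset> V" "V \<subseteq> U"
    and min: "\<And>W. left_ideal R W \<Longrightarrow> I \<subset> W \<Longrightarrow> W \<subseteq> U \<Longrightarrow> strict_rank R V \<le> strict_rank R W" by blast
  have "Z = I \<or> Z = V" if Z: "left_ideal R Z" "I \<subseteq> Z" "Z \<subseteq> V" for Z
  proof (rule ccontr)
    assume "\<not> (Z = I \<or> Z = V)"
    then have "I \<subset> Z" "Z \<subset> V" using Z by auto
    then have "strict_rank R Z < strict_rank R V" using strict_rank_less V Z by auto
    then show False
      using min[OF Z(1) \<open>I \<subset> Z\<close> subset_trans[OF Z(3) V(3)]] by simp
  qed
  then have "covers R I V" unfolding covers_def using V assms by blast
  then show ?thesis using V by blast
qed

lemma ex_max_left_ideal: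
  assumes "left_ideal R I" "\<one> \<notin> I"
  shows "\<exists>m. I \<subseteq> m \<and> max_left_ideal R m"
  using ex_covers_below[OF assms(1) left_ideal_carrier] assms left_idealD(1)[OF assms(1)] by blast

text \<open>The simple module with a given annihilator is unique: the conclusion says that \<open>1 \<mapsto> c\<close> induces an isomorphism
\<open>R / m2 \<cong> R / m1\<close>.  Choose a left ideal \<open>B\<close> minimal among those not contained in \<open>m2\<close>, so that
\<open>B \<inter> m2\<close> is its only maximal subideal.  As \<open>B\<close> does not annihilate \<open>R / m1\<close>, right
multiplication by some \<open>c0\<close> gives a nonzero map \<open>B \<rightarrow> R / m1\<close>, whose kernel must be \<open>B \<inter> m2\<close>; on the other
hand \<open>B / (B \<inter> m2) \<cong> R / m2\<close>.\<close>

lemma simple_iso_if_core_subset: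
  assumes m1: "max_left_ideal R m1" and m2: "max_left_ideal R m2" and le: "core R m1 \<subseteq> core R m2"
  shows "\<exists>c\<in>carrier R. c \<notin> m1 \<and> colon R m1 c = m2"
proof -
  note I1 = coversD(1)[OF m1] and I2 = coversD(1)[OF m2]
  note one2 = max_left_ideal_one[OF m2]
  obtain B where B: "left_ideal R B" "\<not> B \<subseteq> m2"
    and min: "\<And>C. left_ideal R C \<Longrightarrow> \<not> C \<subseteq> m2 \<Longrightarrow> strict_rank R B \<le> strict_rank R C"
    using ex_has_least_nat[of "\<lambda>B. left_ideal R B \<and> \<not> B \<subseteq> m2" "carrier R" "strict_rank R"]
      left_ideal_carrier one2 by auto
  have small: "C \<subseteq> m2" if C: "left_ideal R C" "C \<subset> B" for C
  proof (rule ccontr)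
    assume "\<not> C \<subseteq> m2"
    with min[OF C(1)] strict_rank_less[OF C(1) B(1) C(2)] show False by simp
  qed
  note Bc = left_idealD(1)[OF B(1)]
  have "\<not> B \<subseteq> core R m1"
    using B(2) le core_subset[of m2] by blast
  then obtain b1 c0 where b1: "b1 \<in> B" "c0 \<in> carrier R" "b1 \<otimes> c0 \<notin> m1"
    using Bc by (auto simp: core_def)
  \<comment> \<open>The kernel of the map given by right multiplication with \<open>c0\<close>.\<close>
  let ?C = "B \<inter> colon R m1 c0"
  have "left_ideal R ?C" by (rule left_ideal_Int[OF B(1) left_ideal_colon[OF I1 b1(2)]])
  moreover have "?C \<subset> B" using b1 by (auto simp: colon_def)
  ultimately have C: "?C \<subseteq> m2" by (rule small)
  have iff: "b \<otimes> c0 \<in> m1 \<longleftrightarrow> b \<in> m2" if b: "b \<in> B" for b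
  proof
    assume "b \<otimes> c0 \<in> m1"
    then show "b \<in> m2" using C b Bc by (auto simp: colon_def)
  next
    assume bm: "b \<in> m2"
    show "b \<otimes> c0 \<in> m1"
    proof (rule ccontr)
      assume n: "b \<otimes> c0 \<notin> m1"
      obtain b0 where b0: "b0 \<in> B" "b0 \<notin> m2" using B(2) by blast
      note c = Bc[OF b] Bc[OF b0(1)] b1(2)
      obtain a where a: "a \<in> carrier R" "b0 \<otimes> c0 \<ominus> a \<otimes> (b \<otimes> c0) \<in> m1"
        using covers_elem[OF m1 _ n, of "b0 \<otimes> c0"] c by auto
      have ab: "a \<otimes> b \<in> B" using left_idealD(4)[OF B(1)] a b by blast
      have "(b0 \<ominus> a \<otimes> b) \<otimes> c0 \<in> m1" using a c by (simp add: l_distr_minus m_assoc)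
      moreover have "b0 \<ominus> a \<otimes> b \<in> B" using left_ideal_minus[OF B(1) b0(1) ab] .
      ultimately have "b0 \<ominus> a \<otimes> b \<in> m2" using C Bc by (auto simp: colon_def)
      moreover have "a \<otimes> b \<in> m2" using left_idealD(4)[OF I2] a bm by blast
      ultimately have "b0 \<in> m2" using left_ideal_minus_iff[OF I2, of b0 "a \<otimes> b"] a c by simp
      then show False using b0 by simp
    qed
  qed
  obtain b0 where b0: "b0 \<in> B" "b0 \<notin> m2" using B(2) by blast
  obtain a0 where a0: "a0 \<in> carrier R" "\<one> \<ominus> a0 \<otimes> b0 \<in> m2"
    using covers_elem[OF m2 _ b0(2), of \<one>] Bc[OF b0(1)] by auto
  \<comment> \<open>An element of \<open>B\<close> that is congruent to \<open>1\<close> modulo \<open>m2\<close>, so that \<open>?e \<otimes> c0\<close> serves as \<open>c\<close>.\<close>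
  let ?e = "a0 \<otimes> b0"
  have e: "?e \<in> B" using left_idealD(4)[OF B(1)] a0 b0 by blast
  note ec = Bc[OF e]
  have "a \<in> colon R m1 (?e \<otimes> c0) \<longleftrightarrow> a \<in> m2" if a: "a \<in> carrier R" for a
  proof -
    have "a \<otimes> ?e \<in> B" using left_idealD(4)[OF B(1)] a e by blast
    then have "a \<in> colon R m1 (?e \<otimes> c0) \<longleftrightarrow> a \<otimes> ?e \<in> m2"
      using iff[of "a \<otimes> ?e"] a ec b1(2) by (simp add: colon_def m_assoc[OF a ec b1(2)])
    moreover have "a \<ominus> a \<otimes> ?e \<in> m2"
      using left_idealD(4)[OF I2 a a0(2)] a ec r_distr_minus[OF one_closed ec a] by simp
    ultimately show ?thesis
      using left_ideal_minus_iff[OF I2 a _ \<open>a \<ominus> a \<otimes> ?e \<in> m2\<close>] a ec by simp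
  qed
  moreover have "colon R m1 (?e \<otimes> c0) \<subseteq> carrier R" "m2 \<subseteq> carrier R"
    using left_idealD(1)[OF I2] by (auto simp: colon_def)
  ultimately have eq: "colon R m1 (?e \<otimes> c0) = m2" by blast
  moreover have "?e \<otimes> c0 \<notin> m1"
    using eq one2 ec b1(2) by (auto simp: colon_def)
  ultimately show ?thesis using ec b1(2) by blast
qed

text \<open>The isomorphism of the preceding lemma is invertible; \<open>a\<close> below represents the image of \<open>1\<close> under its inverse.\<close>

lemma core_eq_if_subset:
  assumes m1: "max_left_ideal R m1" and m2: "max_left_ideal R m2" and le: "core R m1 \<subseteq> core R m2"
  shows "core R m1 = core R m2"
proof -
  note I1 = coversD(1)[OF m1] and I2 = coversD(1)[OF m2]
  obtain c where c: "c \<in> carrier R" "c \<notin> m1" "colon R m1 c = m2"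
    using simple_iso_if_core_subset[OF assms] by blast
  obtain a where a: "a \<in> carrier R" "\<one> \<ominus> a \<otimes> c \<in> m1"
    using covers_elem[OF m1 c(1,2) one_closed] by blast
  have "a \<notin> m2"
  proof
    assume "a \<in> m2"
    then have "a \<otimes> c \<in> m1" using c by (auto simp: colon_def)
    then have "\<one> \<in> m1" using left_ideal_minus_iff[OF I1, of \<one> "a \<otimes> c"] a c by simp
    then show False using max_left_ideal_one[OF m1] by simp
  qed
  moreover have "x \<otimes> a \<in> m2" if x: "x \<in> m1" for x
  proof -
    have xc: "x \<in> carrier R" using left_idealD(1)[OF I1 x] .
    have "x \<ominus> x \<otimes> (a \<otimes> c) \<in> m1"
      using left_idealD(4)[OF I1 xc a(2)] xc a c r_distr_minus[OF one_closed _ xc, of "a \<otimes> c"] by simp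
    then have "x \<otimes> (a \<otimes> c) \<in> m1"
      using left_ideal_minus_iff[OF I1 xc, of "x \<otimes> (a \<otimes> c)"] x xc a c by simp
    then show ?thesis using c xc a by (auto simp: colon_def m_assoc)
  qed
  ultimately have "colon R m2 a = m1" by (intro colon_eq_max[OF m1 I2 a(1)])
  then show ?thesis using core_subset_core_colon[OF a(1), of m2] le by auto
qed

text \<open>A proper two-sided ideal \<open>Q\<close> above \<open>core R m\<close> lies in some maximal left ideal \<open>m'\<close>, and then
\<open>R / m'\<close> has an annihilator containing that of \<open>R / m\<close>, so both annihilators are equal.
Together with the next lemma this matches the simple left modules with the maximal two-sided ideals.  As the latter notion is symmetric,
the same ideals classify the simple right modules.\<close>

lemma max_two_sided_core:
  assumes m: "max_left_ideal R m"
  shows "max_two_sided R (core R m)"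
  unfolding max_two_sided_def
proof (intro conjI allI impI)
  note I = coversD(1)[OF m]
  show "two_sided R (core R m)"
    using left_ideal_core[OF I] right_ideal_core[OF I] by (simp add: two_sided_def)
  show "\<one> \<notin> core R m" using core_subset max_left_ideal_one[OF m] by blast
  fix Q assume Q: "two_sided R Q" "\<one> \<notin> Q" "core R m \<subseteq> Q"
  then obtain m' where m': "Q \<subseteq> m'" "max_left_ideal R m'"
    using ex_max_left_ideal[of Q] by (auto simp: two_sided_def)
  then have "Q \<subseteq> core R m'" using core_greatest Q by (auto simp: two_sided_def)
  moreover from this have "core R m = core R m'"
    using core_eq_if_subset[OF m m'(2)] Q by blast
  ultimately show "Q = core R m" using Q by blast
qed

lemma ex_max_left_ideal_core:
  assumes P: "max_two_sided R P"
  shows "\<exists>m. max_left_ideal R m \<and> core R m = P"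
proof -
  have PD: "left_ideal R P" "right_ideal R P" "\<one> \<notin> P"
    using P by (auto simp: max_two_sided_def two_sided_def)
  obtain m where m: "P \<subseteq> m" "max_left_ideal R m"
    using ex_max_left_ideal PD by blast
  have "P \<subseteq> core R m" using core_greatest PD m by blast
  then have "core R m = P"
    using P max_two_sided_core[OF m(2)] unfolding max_two_sided_def by blast
  then show ?thesis using m by blast
qed

text \<open>Take finitely many maximal two-sided ideals whose intersection is as small as possible.  The intersection is contained in
every further maximal ideal \<open>P\<close>, and \<open>P\<close> is prime, so \<open>P\<close> is one of the chosen ideals.\<close>

lemma finite_max_two_sided: "finite {P. max_two_sided R P}"
proof -
  let ?B = "\<lambda>F. carrier R \<inter> \<Inter>F"
  have two: "two_sided R (?B F)" if "F \<subseteq> {P. max_two_sided R P}" for F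
    using that by (auto simp: two_sided_def left_ideal_def max_two_sided_def)
  obtain F where F: "finite F" "F \<subseteq> {P. max_two_sided R P}"
    and min: "\<And>G. finite G \<Longrightarrow> G \<subseteq> {P. max_two_sided R P} \<Longrightarrow> strict_rank R (?B F) \<le> strict_rank R (?B G)"
    using ex_has_least_nat[of "\<lambda>F. finite F \<and> F \<subseteq> {P. max_two_sided R P}" "{}" "\<lambda>F. strict_rank R (?B F)"]
    by auto
  have prime: "\<exists>Q\<in>G. Q \<subseteq> P"
    if P: "max_two_sided R P" and G: "finite G" "G \<subseteq> {P. max_two_sided R P}" "?B G \<subseteq> P" for P G
    using G
  proof (induction G rule: finite_induct)
    case empty
    then show ?case using P by (auto simp: max_two_sided_def)
  next
    case (insert Q G)
    have "two_sided R Q" using insert.prems(1) by (auto simp: max_two_sided_def)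
    moreover have "two_sided R (?B G)" using two insert.prems(1) by blast
    moreover have "Q \<inter> ?B G \<subseteq> P" using insert.prems(2) by auto
    ultimately have "Q \<subseteq> P \<or> ?B G \<subseteq> P" using max_two_sided_prime[OF P] by blast
    then show ?case using insert.IH insert.prems(1) by blast
  qed
  have "P \<in> F" if P: "max_two_sided R P" for P
  proof -
    have "?B F \<subseteq> P"
    proof (rule ccontr)
      assume n: "\<not> ?B F \<subseteq> P"
      then have "?B (insert P F) \<subset> ?B F" by auto
      moreover have "left_ideal R (?B (insert P F))" "left_ideal R (?B F)"
        using two[of "insert P F"] two[of F] F P by (auto simp: two_sided_def)
      ultimately have "strict_rank R (?B (insert P F)) < strict_rank R (?B F)" by (intro strict_rank_less)
      moreover have "strict_rank R (?B F) \<le> strict_rank R (?B (insert P F))"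
        using min[of "insert P F"] F P by auto
      ultimately show False by simp
    qed
    then obtain Q where Q: "Q \<in> F" "Q \<subseteq> P" using prime[OF P F] by blast
    then have "max_two_sided R Q" using F(2) by blast
    from max_two_sidedD(3)[OF this max_two_sidedD(1,2)[OF P] Q(2)] have "P = Q" .
    then show ?thesis using Q by simp
  qed
  then show ?thesis by (intro finite_subset[OF _ F(1)] subsetI) simp
qed

end

section \<open>Duals of simple modules as annihilators\<close>

locale finite_length_ring = left_finite_length R + op: left_finite_length "opposite_ring R"
  for R (structure)
begin

lemma finite_length_ring_opposite: "finite_length_ring (opposite_ring R)"
  unfolding finite_length_ring_def
  using op.left_finite_length_axioms left_finite_length_axioms by simp

lemma colon_opposite: "colon (opposite_ring R) I u = {a \<in> carrier R. u \<otimes> a \<in> I}"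
  by (simp add: colon_def)

text \<open>The simple right module \<open>N\<close> is generated by \<open>y\<close>, so it is isomorphic to \<open>R / n\<close>, where
\<open>n\<close> is the annihilator of \<open>y\<close>.  Both sides are the annihilator of this module.\<close>

lemma core_min_right_ideal:
  assumes N: "min_right_ideal R N" and y: "y \<in> N" "y \<noteq> \<zero>"
  shows "core (opposite_ring R) (colon (opposite_ring R) {\<zero>} y) = rann R N"
proof -
  have NI: "right_ideal R N" using op.coversD(2)[OF N] .
  have yc: "y \<in> carrier R" using op.left_idealD(1)[OF NI y(1)] by simp
  have "\<exists>b\<in>carrier R. x = y \<otimes> b" if x: "x \<in> N" for x
  proof -
    have "x \<in> carrier R" using op.left_idealD(1)[OF NI x] by simp
    moreover obtain b where "b \<in> carrier R" "x \<ominus> y \<otimes> b \<in> {\<zero>}"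
      using op.covers_elem[OF N, of y x] x y by auto
    ultimately show ?thesis using yc by auto
  qed
  moreover have "y \<otimes> b \<in> N" if "b \<in> carrier R" for b
    using op.left_idealD(4)[OF NI, of b y] that y by simp
  ultimately show ?thesis
    using yc unfolding core_def rann_def colon_def by (fastforce simp: m_assoc)
qed

text \<open>By uniqueness of the simple module with a given annihilator, \<open>N \<cong> R / n\<close>; take for \<open>y\<close> the image
of \<open>1\<close>.\<close>

lemma generator_with_annihilator:
  assumes N: "min_right_ideal R N" and n: "max_right_ideal R n"
    and eq: "core (opposite_ring R) n = rann R N"
  shows "\<exists>y\<in>N. y \<noteq> \<zero> \<and> colon (opposite_ring R) {\<zero>} y = n"
proof -
  have NI: "right_ideal R N" using op.coversD(2)[OF N] .
  have sub: "{\<zero>} \<subset> N" using op.coversD(3)[OF N] by simp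
  then obtain y0 where y0: "y0 \<in> N" "y0 \<noteq> \<zero>" by blast
  have yc: "y0 \<in> carrier R" using op.left_idealD(1)[OF NI y0(1)] by simp
  let ?n0 = "colon (opposite_ring R) {\<zero>} y0"
  have n0: "max_right_ideal R ?n0"
    using op.covers_colon[OF N, of y0] y0 by simp
  have "core (opposite_ring R) ?n0 \<subseteq> core (opposite_ring R) n"
    using core_min_right_ideal[OF N y0] eq by simp
  then obtain c where c: "c \<in> carrier R" "c \<notin> ?n0" "colon (opposite_ring R) ?n0 c = n"
    using op.simple_iso_if_core_subset[of ?n0 n] n0 n by auto
  have "y0 \<otimes> c \<in> N" using op.left_idealD(4)[OF NI, of c y0] y0 c by simp
  moreover have "y0 \<otimes> c \<noteq> \<zero>" using c by (simp add: colon_opposite)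
  moreover have "colon (opposite_ring R) {\<zero>} (y0 \<otimes> c) = n"
    using c yc by (auto simp: colon_opposite m_assoc)
  ultimately show ?thesis by blast
qed

end

text \<open>All simple left modules \<open>R / m\<close> are reflexive: for \<open>M = R / m\<close> the two assumptions are injectivity and surjectivity of the evaluation
map \<open>M \<rightarrow> M\<^sup>*\<^sup>*\<close>.\<close>

locale reflexive_simples = finite_length_ring R for R (structure) +
  assumes double_annihilator:
      "\<lbrakk>max_left_ideal R m; a \<in> carrier R; \<And>x. x \<in> rann R m \<Longrightarrow> a \<otimes> x = \<zero>\<rbrakk> \<Longrightarrow> a \<in> m"
    and hom_left_multiplication:
      "\<lbrakk>max_left_ideal R m; \<And>x. x \<in> rann R m \<Longrightarrow> g x \<in> carrier R;
        \<And>x y. x \<in> rann R m \<Longrightarrow> y \<in> rann R m \<Longrightarrow> g (x \<oplus> y) = g x \<oplus> g y;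
        \<And>x a. x \<in> rann R m \<Longrightarrow> a \<in> carrier R \<Longrightarrow> g (x \<otimes> a) = g x \<otimes> a\<rbrakk>
       \<Longrightarrow> \<exists>c\<in>carrier R. \<forall>x\<in>rann R m. g x = c \<otimes> x"
begin

lemma rann_max_left_ideal:
  assumes m: "max_left_ideal R m"
  shows "right_ideal R (rann R m)" "{\<zero>} \<subset> rann R m"
proof -
  have mc: "m \<subseteq> carrier R" using left_idealD(1)[OF coversD(1)[OF m]] by blast
  show r: "right_ideal R (rann R m)" by (rule right_ideal_rann[OF mc])
  have "\<zero> \<in> rann R m" using op.left_idealD(2)[OF r] by simp
  moreover have "rann R m \<noteq> {\<zero>}"
  proof
    assume "rann R m = {\<zero>}"
    then have "\<one> \<in> m" by (intro double_annihilator[OF m one_closed]) simp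
    then show False using max_left_ideal_one[OF m] by blast
  qed
  ultimately show "{\<zero>} \<subset> rann R m" by blast
qed

text \<open>A homomorphism \<open>rann R m / V \<rightarrow> R\<close> with \<open>u \<mapsto> y\<close> exists when \<open>y\<close> is killed by the annihilator of
\<open>u + V\<close>; composed with the projection it is a homomorphism on \<open>rann R m\<close>, hence a left multiplication.\<close>

lemma ex_left_multiplier:
  assumes m: "max_left_ideal R m" and V: "covers (opposite_ring R) V (rann R m)"
    and u: "u \<in> rann R m" "u \<notin> V" and y: "y \<in> carrier R"
    and ann: "\<And>a. a \<in> carrier R \<Longrightarrow> u \<otimes> a \<in> V \<Longrightarrow> y \<otimes> a = \<zero>"
  shows "\<exists>c\<in>carrier R. c \<otimes> u = y \<and> (\<forall>v\<in>V. c \<otimes> v = \<zero>)"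
proof -
  note VI = op.coversD(1)[OF V] and UI = op.coversD(2)[OF V]
  have Vc: "\<And>v. v \<in> V \<Longrightarrow> v \<in> carrier R" and Uc: "\<And>x. x \<in> rann R m \<Longrightarrow> x \<in> carrier R"
    using op.left_idealD(1)[OF VI] op.left_idealD(1)[OF UI] by auto
  note uc = Uc[OF u(1)]
  \<comment> \<open>Every \<open>x\<close> in \<open>rann R m\<close> is congruent modulo \<open>V\<close> to \<open>u\<close> times \<open>coef x\<close>, and \<open>y\<close> times \<open>coef x\<close> does not depend on the choice.\<close>
  define coef where "coef x = (SOME a. a \<in> carrier R \<and> x \<ominus> u \<otimes> a \<in> V)" for x
  have coef: "coef x \<in> carrier R" "x \<ominus> u \<otimes> coef x \<in> V" if "x \<in> rann R m" for x
  proof -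
    have "\<exists>a. a \<in> carrier R \<and> x \<ominus> u \<otimes> a \<in> V"
      using op.covers_elem[OF V u that] by auto
    from someI_ex[OF this] show "coef x \<in> carrier R" "x \<ominus> u \<otimes> coef x \<in> V"
      unfolding coef_def by auto
  qed
  have g: "y \<otimes> coef x = y \<otimes> a" if x: "x \<in> rann R m" and a: "a \<in> carrier R" "x \<ominus> u \<otimes> a \<in> V" for x a
  proof -
    note cx = coef[OF x]
    have "(x \<ominus> u \<otimes> a) \<ominus> (x \<ominus> u \<otimes> coef x) \<in> V"
      using op.left_ideal_minus[OF VI a(2) cx(2)] by simp
    moreover have "(x \<ominus> u \<otimes> a) \<ominus> (x \<ominus> u \<otimes> coef x) = u \<otimes> (coef x \<ominus> a)"
    proof -
      have "(x \<ominus> p) \<ominus> (x \<ominus> q) = q \<ominus> p" if "p \<in> carrier R" "q \<in> carrier R" for p q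
      proof -
        have "(x \<ominus> p) \<ominus> (x \<ominus> q) = (x \<oplus> \<ominus> x) \<oplus> (q \<oplus> \<ominus> p)"
          using that Uc[OF x] by (simp add: a_minus_def minus_add a_ac)
        then show ?thesis using that Uc[OF x] by (simp add: a_minus_def r_neg)
      qed
      then show ?thesis using uc cx a by (simp add: r_distr_minus)
    qed
    ultimately have "y \<otimes> (coef x \<ominus> a) = \<zero>" using ann cx a by simp
    then show ?thesis using y cx a by (simp add: r_distr_minus)
  qed
  have "\<exists>c\<in>carrier R. \<forall>x\<in>rann R m. y \<otimes> coef x = c \<otimes> x"
  proof (rule hom_left_multiplication[OF m])
    fix x assume x: "x \<in> rann R m"
    then show "y \<otimes> coef x \<in> carrier R" using coef y by simp
    { fix z assume z: "z \<in> rann R m"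
      have xz: "x \<oplus> z \<in> rann R m" using op.left_idealD(3)[OF UI x z] by simp
      have "(x \<oplus> z) \<ominus> u \<otimes> (coef x \<oplus> coef z) = (x \<ominus> u \<otimes> coef x) \<oplus> (z \<ominus> u \<otimes> coef z)"
        using x z Uc uc coef by (simp add: a_minus_def r_distr minus_add a_ac)
      also have "\<dots> \<in> V" using op.left_idealD(3)[OF VI coef(2)[OF x] coef(2)[OF z]] by simp
      finally have "y \<otimes> coef (x \<oplus> z) = y \<otimes> (coef x \<oplus> coef z)"
        using coef(1)[OF x] coef(1)[OF z] by (intro g[OF xz]) simp_all
      then show "y \<otimes> coef (x \<oplus> z) = y \<otimes> coef x \<oplus> y \<otimes> coef z"
        using coef(1)[OF x] coef(1)[OF z] y by (simp add: r_distr) }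
    { fix a assume a: "a \<in> carrier R"
      have xa: "x \<otimes> a \<in> rann R m" using op.left_idealD(4)[OF UI, of a x] x a by simp
      have "x \<otimes> a \<ominus> u \<otimes> (coef x \<otimes> a) = (x \<ominus> u \<otimes> coef x) \<otimes> a"
        using x Uc uc coef a by (simp add: l_distr_minus m_assoc)
      also have "\<dots> \<in> V" using op.left_idealD(4)[OF VI, of a] coef(2)[OF x] a by simp
      finally have "y \<otimes> coef (x \<otimes> a) = y \<otimes> (coef x \<otimes> a)"
        using coef(1)[OF x] a by (intro g[OF xa]) simp_all
      then show "y \<otimes> coef (x \<otimes> a) = y \<otimes> coef x \<otimes> a"
        using coef(1)[OF x] y a by (simp add: m_assoc) }
  qed
  then obtain c where c: "c \<in> carrier R" "\<And>x. x \<in> rann R m \<Longrightarrow> y \<otimes> coef x = c \<otimes> x" by blast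
  have "u \<ominus> u \<otimes> \<one> \<in> V" using uc op.left_idealD(2)[OF VI] by (simp add: a_minus_def r_neg)
  then have "c \<otimes> u = y" using g[OF u(1) one_closed] c(2)[OF u(1)] y by simp
  moreover have "c \<otimes> v = \<zero>" if v: "v \<in> V" for v
  proof -
    have vU: "v \<in> rann R m" using op.coversD(3)[OF V] v by blast
    have "v \<ominus> u \<otimes> \<zero> \<in> V" using Vc[OF v] uc v by (simp add: a_minus_def)
    then show ?thesis using g[OF vU zero_closed] c(2)[OF vU] y by simp
  qed
  ultimately show ?thesis using c(1) by blast
qed

text \<open>If a simple quotient \<open>rann R m / V\<close> of the dual of \<open>R / m\<close> is isomorphic to a simple submodule
\<open>y R\<close> of the dual of \<open>R / m'\<close>, then dualizing the composite \<open>(R / m)\<^sup>* \<rightarrow> (R / m')\<^sup>*\<close> and using that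
\<open>R / m\<close> is reflexive gives a nonzero map \<open>R / m' \<rightarrow> R / m\<close>, \<open>1 \<mapsto> c\<close>.
All three comparisons of simple modules below, and the final step for \<open>T\<close>, are instances.\<close>

lemma iso_if_common_dual_factor:
  assumes m: "max_left_ideal R m" and m': "max_left_ideal R m'"
    and V: "covers (opposite_ring R) V (rann R m)" and u: "u \<in> rann R m" "u \<notin> V"
    and y: "y \<in> rann R m'" "y \<noteq> \<zero>"
    and ann: "\<And>a. a \<in> carrier R \<Longrightarrow> u \<otimes> a \<in> V \<Longrightarrow> y \<otimes> a = \<zero>"
  shows "\<exists>c\<in>carrier R. c \<notin> m \<and> colon R m c = m' \<and> (\<forall>v\<in>V. c \<otimes> v = \<zero>)"
proof -
  note I = coversD(1)[OF m] and I' = coversD(1)[OF m']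
  note VI = op.coversD(1)[OF V] and UI = op.coversD(2)[OF V]
  have Vc: "\<And>v. v \<in> V \<Longrightarrow> v \<in> carrier R" and Uc: "\<And>x. x \<in> rann R m \<Longrightarrow> x \<in> carrier R"
    using op.left_idealD(1)[OF VI] op.left_idealD(1)[OF UI] by auto
  have yc: "y \<in> carrier R" using y(1) by (simp add: rann_def)
  obtain c where c: "c \<in> carrier R" "c \<otimes> u = y" "\<And>v. v \<in> V \<Longrightarrow> c \<otimes> v = \<zero>"
    using ex_left_multiplier[OF m V u yc ann] by blast
  have "c \<notin> m" using c(2) y(2) u(1) by (auto simp: rann_def)
  moreover have "b \<otimes> c \<in> m" if b: "b \<in> m'" for b
  proof (rule double_annihilator[OF m])
    have bc: "b \<in> carrier R" using left_idealD(1)[OF I' b] .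
    then show "b \<otimes> c \<in> carrier R" using c by simp
    have bcu: "b \<otimes> c \<otimes> u = \<zero>" using y(1) b bc c Uc[OF u(1)] by (simp add: m_assoc rann_def)
    fix x assume x: "x \<in> rann R m"
    obtain a where a: "a \<in> carrier R" "x \<ominus> u \<otimes> a \<in> V"
      using op.covers_elem[OF V u x] by auto
    have xc: "x \<in> carrier R" "u \<in> carrier R" using Uc x u by auto
    have "b \<otimes> c \<otimes> (x \<ominus> u \<otimes> a) = \<zero>"
      using c(3)[OF a(2)] bc c(1) Vc[OF a(2)] by (simp add: m_assoc)
    moreover have "b \<otimes> c \<otimes> (u \<otimes> a) = \<zero>"
      using bcu bc c(1) xc a by (simp add: m_assoc[symmetric])
    ultimately show "b \<otimes> c \<otimes> x = \<zero>"
      using bc c(1) xc a by (simp add: r_distr_minus)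
  qed
  ultimately show ?thesis using colon_eq_max[OF m' I c(1)] c by blast
qed

lemma core_eq_if_common_dual_factor:
  assumes "max_left_ideal R m" "max_left_ideal R m'"
    and "covers (opposite_ring R) V (rann R m)" "u \<in> rann R m" "u \<notin> V"
    and "y \<in> rann R m'" "y \<noteq> \<zero>"
    and "\<And>a. a \<in> carrier R \<Longrightarrow> u \<otimes> a \<in> V \<Longrightarrow> y \<otimes> a = \<zero>"
  shows "core R m = core R m'"
proof -
  obtain c where "c \<in> carrier R" "colon R m c = m'"
    using iso_if_common_dual_factor[OF assms] by blast
  then show ?thesis
    using core_subset_core_colon[of c m] core_eq_if_subset[OF assms(1,2)] by simp
qed

text \<open>Reflexive modules with isomorphic duals are isomorphic.\<close>

lemma core_eq_if_rann_rann_eq: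
  assumes m: "max_left_ideal R m" and m': "max_left_ideal R m'"
    and N: "min_right_ideal R (rann R m)" and N': "min_right_ideal R (rann R m')"
    and eq: "rann R (rann R m) = rann R (rann R m')"
  shows "core R m = core R m'"
proof -
  obtain u where u: "u \<in> rann R m" "u \<noteq> \<zero>" using rann_max_left_ideal(2)[OF m] by blast
  let ?n = "colon (opposite_ring R) {\<zero>} u"
  have n: "max_right_ideal R ?n" using op.covers_colon[OF N, of u] u by simp
  have "core (opposite_ring R) ?n = rann R (rann R m')"
    using core_min_right_ideal[OF N u] eq by simp
  then obtain y where y: "y \<in> rann R m'" "y \<noteq> \<zero>" "colon (opposite_ring R) {\<zero>} y = ?n"
    using generator_with_annihilator[OF N' n] by blast
  show ?thesis
    using N y u by (intro core_eq_if_common_dual_factor[OF m m', of "{\<zero>}" u y])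
      (auto simp: colon_opposite set_eq_iff)
qed

definition representative :: "'a set \<Rightarrow> 'a set" where
  "representative P = (SOME m. max_left_ideal R m \<and> core R m = P)"

lemma representative:
  assumes "max_two_sided R P"
  shows "max_left_ideal R (representative P)" "core R (representative P) = P"
  using someI_ex[OF ex_max_left_ideal_core[OF assms]] by (auto simp: representative_def)

text \<open>With isomorphism classes of simple modules represented by annihilators, this is the map induced by duality
from the simple left modules with simple dual to the simple right modules.\<close>

definition dual_class :: "'a set \<Rightarrow> 'a set" where
  "dual_class P = rann R (rann R (representative P))"

lemma dual_class:
  assumes P: "max_two_sided R P" and N: "min_right_ideal R (rann R (representative P))"
  shows "max_two_sided R (dual_class P)"
proof -
  obtain u where u: "u \<in> rann R (representative P)" "u \<noteq> \<zero>"
    using rann_max_left_ideal(2)[OF representative(1)[OF P]] by blast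
  have "max_right_ideal R (colon (opposite_ring R) {\<zero>} u)"
    using op.covers_colon[OF N, of u] u by simp
  from op.max_two_sided_core[of "colon (opposite_ring R) {\<zero>} u"] this show ?thesis
    using core_min_right_ideal[OF N u] by (simp add: dual_class_def)
qed

lemma dual_class_inj:
  "inj_on dual_class {P. max_two_sided R P \<and> min_right_ideal R (rann R (representative P))}"
proof (rule inj_onI)
  fix P Q
  assume P: "P \<in> {P. max_two_sided R P \<and> min_right_ideal R (rann R (representative P))}"
    and Q: "Q \<in> {P. max_two_sided R P \<and> min_right_ideal R (rann R (representative P))}"
    and eq: "dual_class P = dual_class Q"
  have "core R (representative P) = core R (representative Q)"
    using P Q eq representative(1)[of P] representative(1)[of Q]
    by (intro core_eq_if_rann_rann_eq) (auto simp: dual_class_def)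
  then show "P = Q" using representative(2) P Q by simp
qed

text \<open>Here \<open>R / m\<close> is the distinguished simple module and \<open>?U\<close> is its dual.  The simple quotient \<open>?U / V\<close> and the simple
submodule \<open>N\<close> of \<open>?U\<close> both miss all the dual classes of the other simple modules.  By counting, only one class of
simple right modules is left, so the two are isomorphic, and \<open>iso_if_common_dual_factor\<close> applies
with \<open>m' = m\<close>.\<close>

theorem rann_minimal_if_others_minimal:
  assumes m: "max_left_ideal R m"
    and others: "\<And>m'. max_left_ideal R m' \<Longrightarrow> core R m' \<noteq> core R m \<Longrightarrow> min_right_ideal R (rann R m')"
  shows "min_right_ideal R (rann R m)"
proof -
  let ?U = "rann R m" and ?op = "opposite_ring R" and ?Max = "{P. max_two_sided R P}"
  let ?D = "?Max - {core R m}"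
  note UI = rann_max_left_ideal[OF m]
  obtain N where N: "min_right_ideal R N" "N \<subseteq> ?U"
    using op.ex_covers_above[of "{\<zero>}" ?U] op.left_ideal_zero UI by auto
  obtain V where V: "covers ?op V ?U"
    using op.ex_covers_below[of "{\<zero>}" ?U] op.left_ideal_zero UI by auto
  obtain u where u: "u \<in> ?U" "u \<notin> V" using op.coversD(3)[OF V] by blast
  obtain x where x: "x \<in> N" "x \<noteq> \<zero>" using op.coversD(3)[OF N(1)] by auto
  have xU: "x \<in> ?U" using x N by blast
  let ?n = "colon ?op V u" and ?k = "colon ?op {\<zero>} x"
  have n: "max_right_ideal R ?n" using op.covers_colon[OF V u] by simp
  have k: "max_right_ideal R ?k" using op.covers_colon[OF N(1), of x] x by simp
  have min: "min_right_ideal R (rann R (representative P))" if "P \<in> ?D" for P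
    using that representative[of P] others by simp
  have img: "dual_class ` ?D \<subseteq> ?Max" using dual_class min by auto
  have inj: "inj_on dual_class ?D"
    by (rule inj_on_subset[OF dual_class_inj]) (use min in auto)
  have n_new: "core ?op ?n \<notin> dual_class ` ?D"
  proof
    assume "core ?op ?n \<in> dual_class ` ?D"
    then obtain P where P: "P \<in> ?D" "core ?op ?n = dual_class P" by blast
    let ?m = "representative P"
    have r: "max_left_ideal R ?m" "core R ?m = P" using representative P by auto
    obtain y where y: "y \<in> rann R ?m" "y \<noteq> \<zero>" "colon ?op {\<zero>} y = ?n"
      using generator_with_annihilator[OF min[OF P(1)] n] P(2) by (auto simp: dual_class_def)
    have "core R m = core R ?m"
      using y by (intro core_eq_if_common_dual_factor[OF m r(1) V u, of y]) (auto simp: colon_opposite set_eq_iff)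
    then show False using P r by simp
  qed
  have k_new: "core ?op ?k \<notin> dual_class ` ?D"
  proof
    assume "core ?op ?k \<in> dual_class ` ?D"
    then obtain P where P: "P \<in> ?D" "core ?op ?k = dual_class P" by blast
    let ?m = "representative P"
    have r: "max_left_ideal R ?m" "core R ?m = P" using representative P by auto
    obtain y where y: "y \<in> rann R ?m" "y \<noteq> \<zero>" "colon ?op {\<zero>} y = ?k"
      using generator_with_annihilator[OF min[OF P(1)] k] P(2) by (auto simp: dual_class_def)
    have "core R ?m = core R m"
      using y xU x min[OF P(1)]
      by (intro core_eq_if_common_dual_factor[OF r(1) m, of "{\<zero>}" y x]) (auto simp: colon_opposite set_eq_iff)
    then show False using P r by simp
  qed
  have "core ?op ?n = core ?op ?k"
  proof (rule ccontr)
    assume ne: "core ?op ?n \<noteq> core ?op ?k"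
    have new: "core ?op ?n \<in> ?Max" "core ?op ?k \<in> ?Max"
      using op.max_two_sided_core[of ?n] op.max_two_sided_core[of ?k] n k by auto
    have "card (insert (core ?op ?n) (insert (core ?op ?k) (dual_class ` ?D))) \<le> card ?Max"
      using new img by (intro card_mono finite_max_two_sided) auto
    moreover have "card (insert (core ?op ?n) (insert (core ?op ?k) (dual_class ` ?D)))
        = Suc (Suc (card ?D))"
      using ne n_new k_new finite_max_two_sided card_image[OF inj] by simp
    moreover have "Suc (card ?D) = card ?Max"
      using max_two_sided_core[OF m] finite_max_two_sided by (intro card.remove[symmetric]) auto
    ultimately show False by simp
  qed
  then have "core ?op ?n = rann R N" using core_min_right_ideal[OF N(1) x] by simp
  then obtain y where y: "y \<in> N" "y \<noteq> \<zero>" "colon ?op {\<zero>} y = ?n"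
    using generator_with_annihilator[OF N(1) n] by blast
  have yU: "y \<in> ?U" using y(1) N(2) by blast
  have ann: "y \<otimes> a = \<zero>" if "a \<in> carrier R" "u \<otimes> a \<in> V" for a
    using that y(3) by (auto simp: colon_opposite set_eq_iff)
  obtain c where c: "c \<in> carrier R" "c \<notin> m" "colon R m c = m" "\<And>v. v \<in> V \<Longrightarrow> c \<otimes> v = \<zero>"
    using iso_if_common_dual_factor[OF m m V u yU y(2) ann] by blast
  \<comment> \<open>Since \<open>c\<close> generates \<open>R\<close> modulo \<open>m\<close>, and both \<open>c\<close> and \<open>m\<close> kill \<open>V\<close>, so does \<open>\<one>\<close>.\<close>
  have "v = \<zero>" if v: "v \<in> V" for v
  proof -
    have vU: "v \<in> ?U" using v op.coversD(3)[OF V] by blast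
    then have vc: "v \<in> carrier R" by (simp add: rann_def)
    obtain a where a: "a \<in> carrier R" "\<one> \<ominus> a \<otimes> c \<in> m"
      using covers_elem[OF m c(1,2) one_closed] by blast
    have "(\<one> \<ominus> a \<otimes> c) \<otimes> v = \<zero>" using vU a(2) by (simp add: rann_def)
    then show ?thesis using a(1) c(1) c(4)[OF v] vc by (simp add: l_distr_minus m_assoc)
  qed
  moreover have "\<zero> \<in> V" using op.left_idealD(2)[OF op.coversD(1)[OF V]] by simp
  ultimately have "V = {\<zero>}" by blast
  then show ?thesis using V by simp
qed

text \<open>The map \<open>dual_class\<close> is an injection of a finite set into itself, hence onto.  Thus \<open>R / n\<close> is
isomorphic to \<open>rann R m = (R / m)\<^sup>*\<close> for some \<open>m\<close>, and its dual is isomorphic to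
\<open>(R / m)\<^sup>*\<^sup>* = R / m\<close>, which is simple.\<close>

theorem lann_minimal:
  assumes min: "\<And>m. max_left_ideal R m \<Longrightarrow> min_right_ideal R (rann R m)"
    and n: "max_right_ideal R n"
  shows "min_left_ideal R (rann (opposite_ring R) n)"
proof -
  let ?Max = "{P. max_two_sided R P}" and ?op = "opposite_ring R"
  have nI: "right_ideal R n" using op.coversD(1)[OF n] .
  have min': "min_right_ideal R (rann R (representative P))" if "P \<in> ?Max" for P
    using that representative[of P] min by simp
  have "inj_on dual_class ?Max"
    by (rule inj_on_subset[OF dual_class_inj]) (use min' in auto)
  moreover have "dual_class ` ?Max \<subseteq> ?Max" using dual_class min' by auto
  ultimately have "dual_class ` ?Max = ?Max"
    using endo_inj_surj finite_max_two_sided by blast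
  moreover have "core ?op n \<in> ?Max" using op.max_two_sided_core[of n] n by simp
  ultimately obtain P where P: "P \<in> ?Max" "core ?op n = dual_class P" by blast
  let ?m = "representative P"
  have m: "max_left_ideal R ?m" using representative P by auto
  note mI = coversD(1)[OF m] and N = min[OF m]
  obtain y where y: "y \<in> rann R ?m" "y \<noteq> \<zero>" "colon ?op {\<zero>} y = n"
    using generator_with_annihilator[OF N n] P(2) by (auto simp: dual_class_def)
  have yc: "y \<in> carrier R" using y(1) by (simp add: rann_def)
  have n_eq: "a \<in> n \<longleftrightarrow> a \<in> carrier R \<and> y \<otimes> a = \<zero>" for a
    using y(3) by (auto simp: colon_opposite)
  show ?thesis
  proof (rule coversI)
    show "left_ideal R {\<zero>}" by (rule left_ideal_zero)
    have "n \<subseteq> carrier R" using n_eq by blast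
    then show L: "left_ideal R (rann ?op n)" using op.right_ideal_rann[of n] by simp
    have "y \<in> rann ?op n" using n_eq yc by (simp add: rann_def)
    then show "{\<zero>} \<subset> rann ?op n" using left_idealD(2)[OF L] y(2) by blast
    fix z x assume z: "z \<in> rann ?op n" "z \<notin> {\<zero>}" and x: "x \<in> rann ?op n"
    have mult: "\<exists>c\<in>carrier R. c \<otimes> y = w" if w: "w \<in> rann ?op n" for w
      using ex_left_multiplier[OF m, of "{\<zero>}" y w] N y w n_eq by (auto simp: rann_def)
    obtain c where c: "c \<in> carrier R" "c \<otimes> y = z" using mult[OF z(1)] by blast
    obtain c' where c': "c' \<in> carrier R" "c' \<otimes> y = x" using mult[OF x] by blast
    have "c \<notin> ?m" using z(2) c y(1) by (auto simp: rann_def)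
    then obtain a where a: "a \<in> carrier R" "c' \<ominus> a \<otimes> c \<in> ?m"
      using covers_elem[OF m c(1) _ c'(1)] by blast
    have "(c' \<ominus> a \<otimes> c) \<otimes> y = \<zero>" using y(1) a(2) by (simp add: rann_def)
    then have "x \<ominus> a \<otimes> z = \<zero>" using a c c' yc by (simp add: l_distr_minus m_assoc)
    then show "\<exists>a\<in>carrier R. x \<ominus> a \<otimes> z \<in> {\<zero>}" using a by blast
  qed
qed

end

section \<open>Comparison of left and right composition lengths\<close>

inductive composition_series :: "('a, 'r) ring_scheme \<Rightarrow> nat \<Rightarrow> 'a set \<Rightarrow> bool" for R where
  zero: "composition_series R 0 {\<zero>\<^bsub>R\<^esub>}"
| step: "composition_series R n I \<Longrightarrow> covers R I J \<Longrightarrow> composition_series R (Suc n) J"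

text \<open>The least length is strictly monotone, and it grows by at most one at a cover.  These two properties drive the
comparison of lengths.\<close>

definition composition_length :: "('a, 'r) ring_scheme \<Rightarrow> 'a set \<Rightarrow> nat" where
  "composition_length R I = (LEAST n. composition_series R n I)"

context ring
begin

text \<open>\<open>L / (L \<inter> I)\<close> embeds into the simple module \<open>J / I\<close>.\<close>

lemma covers_Int:
  assumes IJ: "covers R I J" and L: "left_ideal R L" "L \<subseteq> J" "\<not> L \<subseteq> I"
  shows "covers R (L \<inter> I) L"
proof (rule coversI)
  note I = coversD(1)[OF IJ]
  show "left_ideal R (L \<inter> I)" by (rule left_ideal_Int[OF L(1) I])
  show "L \<inter> I \<subset> L" using L(3) by blast
  fix z x assume z: "z \<in> L" "z \<notin> L \<inter> I" and x: "x \<in> L"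
  obtain a where a: "a \<in> carrier R" "x \<ominus> a \<otimes> z \<in> I"
    using covers_elem[OF IJ, of z x] z x L(2) by blast
  moreover have "x \<ominus> a \<otimes> z \<in> L"
    by (rule left_ideal_minus[OF L(1) x left_idealD(4)[OF L(1) a(1) z(1)]])
  ultimately show "\<exists>a\<in>carrier R. x \<ominus> a \<otimes> z \<in> L \<inter> I" by blast
qed (rule L)

lemma rann_carrier: "rann R (carrier R) = {\<zero>}"
proof -
  have "x = \<zero>" if "x \<in> rann R (carrier R)" for x
  proof -
    have "x \<in> carrier R" "\<one> \<otimes> x = \<zero>" using that by (auto simp: rann_def simp del: l_one)
    then show ?thesis by simp
  qed
  moreover have "\<zero> \<in> rann R (carrier R)" by (simp add: rann_def)
  ultimately show ?thesis by blast
qed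

text \<open>Intersect the series with \<open>L\<close> and drop repetitions.\<close>

lemma composition_series_subideal:
  assumes "composition_series R n I" "left_ideal R L" "L \<subseteq> I"
  shows "\<exists>k\<le>n. composition_series R k L \<and> (L \<noteq> I \<longrightarrow> k < n)"
  using assms
proof (induction arbitrary: L rule: composition_series.induct)
  case zero
  then have "L = {\<zero>}" using left_idealD(2) by blast
  then show ?case using composition_series.zero by blast
next
  case (step n I J)
  show ?case
  proof (cases "L \<subseteq> I")
    case True
    then obtain k where "k \<le> n" "composition_series R k L" using step.IH[OF step.prems(1)] by blast
    then show ?thesis by (intro exI[of _ k]) auto
  next
    case False
    have c: "covers R (L \<inter> I) L" by (rule covers_Int[OF step.hyps(2) step.prems False])
    obtain k where k: "k \<le> n" "composition_series R k (L \<inter> I)" "L \<inter> I \<noteq> I \<longrightarrow> k < n"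
      using step.IH[OF coversD(1)[OF c]] by blast
    have "L = J" if "L \<inter> I = I"
    proof -
      have "I \<subseteq> L" using that by blast
      then have "L = I \<or> L = J" using coversD(4)[OF step.hyps(2) step.prems(1) _ step.prems(2)] by simp
      then show ?thesis using False by blast
    qed
    then show ?thesis using k composition_series.step[OF k(2) c] by (intro exI[of _ "Suc k"]) auto
  qed
qed

end

context left_finite_length
begin

lemma ex_composition_series:
  assumes "left_ideal R I"
  shows "\<exists>n. composition_series R n I"
  using assms
proof (induction "strict_rank R I" arbitrary: I rule: less_induct)
  case less
  show ?case
  proof (cases "I = {\<zero>}")
    case True
    then show ?thesis using composition_series.zero by blast
  next
    case False
    then have "{\<zero>} \<subset> I" using left_idealD(2)[OF less.prems] by blast
    then obtain V where V: "covers R V I"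
      using ex_covers_below[OF left_ideal_zero less.prems] by blast
    obtain n where "composition_series R n V"
      using less.hyps[OF _ coversD(1)[OF V]] strict_rank_less[OF coversD(1,2,3)[OF V]] by blast
    then show ?thesis using composition_series.step V by blast
  qed
qed

lemma composition_series_length: "left_ideal R I \<Longrightarrow> composition_series R (composition_length R I) I"
  unfolding composition_length_def by (rule LeastI_ex[OF ex_composition_series])

lemma composition_length_le: "composition_series R n I \<Longrightarrow> composition_length R I \<le> n"
  unfolding composition_length_def by (rule Least_le)

lemma composition_length_less:
  assumes "left_ideal R I" "left_ideal R J" "I \<subset> J"
  shows "composition_length R I < composition_length R J"
proof -
  obtain k where "composition_series R k I" "k < composition_length R J"
    using composition_series_subideal[OF composition_series_length[OF assms(2)] assms(1)] assms(3) by blast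
  then show ?thesis using composition_length_le[of k I] by simp
qed

lemma composition_length_covers: "covers R I J \<Longrightarrow> composition_length R J \<le> Suc (composition_length R I)"
  by (rule composition_length_le[OF composition_series.step[OF composition_series_length[OF coversD(1)]]])

lemma composition_length_zero: "composition_length R {\<zero>} = 0"
  using composition_length_le[OF composition_series.zero] by simp

end

context finite_length_ring
begin

text \<open>If \<open>u + I\<close> generates \<open>J / I \<cong> R / m\<close>, then \<open>x \<mapsto> u x\<close> embeds \<open>rann R I / rann R J\<close> into the minimal
right ideal \<open>rann R m\<close>.\<close>

lemma rann_covers:
  assumes min: "\<And>m. max_left_ideal R m \<Longrightarrow> min_right_ideal R (rann R m)"
    and IJ: "covers R I J"
  shows "rann R I = rann R J \<or> covers (opposite_ring R) (rann R J) (rann R I)"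
proof (cases "rann R I = rann R J")
  case False
  note I = coversD(1)[OF IJ] and J = coversD(2)[OF IJ]
  have Ic: "I \<subseteq> carrier R" and Jc: "J \<subseteq> carrier R"
    using left_idealD(1)[OF I] left_idealD(1)[OF J] by auto
  have IR: "right_ideal R (rann R I)" and JR: "right_ideal R (rann R J)"
    using right_ideal_rann Ic Jc by auto
  obtain u where u: "u \<in> J" "u \<notin> I" using coversD(3)[OF IJ] by blast
  have uc: "u \<in> carrier R" using u Jc by blast
  let ?m = "colon R I u"
  have m: "max_left_ideal R ?m" by (rule covers_colon[OF IJ u])
  have ux: "u \<otimes> x \<in> rann R ?m" if "x \<in> rann R I" for x
    using that uc by (auto simp: rann_def colon_def m_assoc[symmetric])
  have rannJ: "x \<in> rann R J" if x: "x \<in> rann R I" "u \<otimes> x = \<zero>" for x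
  proof -
    have xc: "x \<in> carrier R" using x by (simp add: rann_def)
    have "j \<otimes> x = \<zero>" if j: "j \<in> J" for j
    proof -
      obtain a where a: "a \<in> carrier R" "j \<ominus> a \<otimes> u \<in> I" using covers_elem[OF IJ u j] by blast
      have jc: "j \<in> carrier R" using j Jc by blast
      have "(j \<ominus> a \<otimes> u) \<otimes> x = \<zero>" using x(1) a(2) by (simp add: rann_def)
      then show ?thesis using a jc uc xc x(2) by (simp add: l_distr_minus m_assoc)
    qed
    then show ?thesis using xc by (simp add: rann_def)
  qed
  have "covers (opposite_ring R) (rann R J) (rann R I)"
  proof (rule op.coversI[OF JR IR])
    have "rann R J \<subseteq> rann R I" using rann_antimono coversD(3)[OF IJ] by blast
    then show "rann R J \<subset> rann R I" using False by blast
    fix z x assume z: "z \<in> rann R I" "z \<notin> rann R J" and x: "x \<in> rann R I"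
    have zx: "z \<in> carrier R" "x \<in> carrier R" using z x by (auto simp: rann_def)
    have "u \<otimes> z \<noteq> \<zero>" using rannJ z by blast
    then obtain a where a: "a \<in> carrier R" "u \<otimes> x \<ominus> u \<otimes> z \<otimes> a = \<zero>"
      using op.covers_elem[OF min[OF m], of "u \<otimes> z" "u \<otimes> x"] ux z x by auto
    have "u \<otimes> (x \<ominus> z \<otimes> a) = \<zero>" using a zx uc by (simp add: r_distr_minus m_assoc)
    moreover have "x \<ominus> z \<otimes> a \<in> rann R I"
      using op.left_ideal_minus[OF IR x op.left_idealD(4)[OF IR _ z(1), of a]] a by simp
    ultimately have "x \<ominus> z \<otimes> a \<in> rann R J" by (intro rannJ)
    then show "\<exists>a\<in>carrier (opposite_ring R).
        x \<ominus>\<^bsub>opposite_ring R\<^esub> a \<otimes>\<^bsub>opposite_ring R\<^esub> z \<in> rann R J"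
      using a by auto
  qed
  then show ?thesis ..
qed simp

text \<open>At each cover on the way down from \<open>J\<close> to \<open>I\<close>, the left length drops by at least one while the right length of
the annihilator grows by at most one.\<close>

lemma composition_length_rann:
  assumes min: "\<And>m. max_left_ideal R m \<Longrightarrow> min_right_ideal R (rann R m)"
    and "left_ideal R I" "left_ideal R J" "I \<subseteq> J"
  shows "composition_length (opposite_ring R) (rann R I) + composition_length R I \<le> composition_length (opposite_ring R) (rann R J) + composition_length R J"
  using assms(2-4)
proof (induction "composition_length R J" arbitrary: J rule: less_induct)
  case less
  show ?case
  proof (cases "I = J")
    case False
    then obtain V where V: "I \<subseteq> V" "covers R V J"
      using ex_covers_below[OF less.prems(1,2)] less.prems(3) by blast
    note VJ = coversD(1,2,3)[OF V(2)]
    have l: "composition_length R V < composition_length R J" by (rule composition_length_less[OF VJ])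
    have "composition_length (opposite_ring R) (rann R I) + composition_length R I \<le> composition_length (opposite_ring R) (rann R V) + composition_length R V"
      using less.hyps[OF l less.prems(1) VJ(1) V(1)] .
    moreover have "composition_length (opposite_ring R) (rann R V) \<le> Suc (composition_length (opposite_ring R) (rann R J))"
      using rann_covers[OF min V(2)] op.composition_length_covers[of "rann R J" "rann R V"] by auto
    ultimately show ?thesis using l by simp
  qed simp
qed

lemma composition_length_opposite_le:
  assumes min: "\<And>m. max_left_ideal R m \<Longrightarrow> min_right_ideal R (rann R m)"
  shows "composition_length (opposite_ring R) (carrier R) \<le> composition_length R (carrier R)"
proof -
  have 1: "rann R {\<zero>} = carrier R" by (auto simp: rann_def)
  show ?thesis
    using composition_length_rann[OF min left_ideal_zero left_ideal_carrier] op.composition_length_zero composition_length_zero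
    by (simp add: 1 rann_carrier)
qed

text \<open>Annihilators of a composition series through \<open>I\<close> and \<open>J\<close> form a series of right ideals from \<open>R\<close> to \<open>0\<close> with at most as many
proper steps as the given one has.  As the left and the right length of \<open>R\<close> agree, no step is lost.\<close>

lemma rann_covers_neq:
  assumes minR: "\<And>m. max_left_ideal R m \<Longrightarrow> min_right_ideal R (rann R m)"
    and minL: "\<And>n. max_right_ideal R n \<Longrightarrow> min_left_ideal R (rann (opposite_ring R) n)"
    and IJ: "covers R I J"
  shows "rann R I \<noteq> rann R J"
proof
  let ?op = "opposite_ring R"
  interpret O: finite_length_ring ?op by (rule finite_length_ring_opposite)
  have z: "rann R {\<zero>} = carrier R" by (auto simp: rann_def)
  have equal: "composition_length ?op (carrier R) = composition_length R (carrier R)"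
  proof (rule antisym)
    show "composition_length ?op (carrier R) \<le> composition_length R (carrier R)" by (rule composition_length_opposite_le[OF minR])
    show "composition_length R (carrier R) \<le> composition_length ?op (carrier R)"
      using O.composition_length_opposite_le minL by simp
  qed
  assume eq: "rann R I = rann R J"
  note I = coversD(1)[OF IJ] and J = coversD(2)[OF IJ]
  have "{\<zero>} \<subseteq> I" "J \<subseteq> carrier R" using left_idealD(2)[OF I] left_idealD(1)[OF J] by auto
  then have "composition_length ?op (carrier R) \<le> composition_length ?op (rann R I) + composition_length R I"
    and "composition_length ?op (rann R J) + composition_length R J \<le> composition_length ?op (rann R (carrier R)) + composition_length R (carrier R)"
    using composition_length_rann[OF minR left_ideal_zero I] composition_length_rann[OF minR J left_ideal_carrier]
    by (simp_all add: z composition_length_zero)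
  moreover have "composition_length ?op (rann R (carrier R)) = 0" using op.composition_length_zero by (simp add: rann_carrier)
  moreover have "composition_length R I < composition_length R J" by (rule composition_length_less[OF I J coversD(3)[OF IJ]])
  ultimately show False using eq equal by simp
qed

text \<open>By induction, \<open>g\<close> agrees on a maximal subideal \<open>I\<close> of \<open>L\<close> with right multiplication by some \<open>b\<close>.  The difference
is a homomorphism on \<open>L / I\<close>, determined by the image of a generator \<open>u\<close> in the minimal right ideal
\<open>rann R (colon R I u)\<close>.  By \<open>rann_covers_neq\<close> some \<open>r\<close> annihilates \<open>I\<close> but not \<open>u\<close>, so \<open>u r\<close> generates
this minimal right ideal and the difference is right multiplication by \<open>r s\<close> for some \<open>s\<close>.\<close>

theorem hom_is_right_multiplication:
  assumes minR: "\<And>m. max_left_ideal R m \<Longrightarrow> min_right_ideal R (rann R m)"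
    and minL: "\<And>n. max_right_ideal R n \<Longrightarrow> min_left_ideal R (rann (opposite_ring R) n)"
    and L: "left_ideal R L"
    and g: "\<And>x. x \<in> L \<Longrightarrow> g x \<in> carrier R"
      "\<And>x y. x \<in> L \<Longrightarrow> y \<in> L \<Longrightarrow> g (x \<oplus> y) = g x \<oplus> g y"
      "\<And>a x. a \<in> carrier R \<Longrightarrow> x \<in> L \<Longrightarrow> g (a \<otimes> x) = a \<otimes> g x"
  shows "\<exists>b\<in>carrier R. \<forall>x\<in>L. g x = x \<otimes> b"
proof -
  show ?thesis
    using L g
  proof (induction "composition_length R L" arbitrary: L g rule: less_induct)
    case less
    note L = less.prems(1) and g = less.prems(2-4)
    have Lc: "\<And>x. x \<in> L \<Longrightarrow> x \<in> carrier R" using left_idealD(1)[OF L] .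
    show ?case
    proof (cases "L = {\<zero>}")
      case True
      have "g (\<zero> \<otimes> \<zero>) = \<zero> \<otimes> g \<zero>" using g(3)[OF zero_closed] True by blast
      then have "g \<zero> = \<zero>" using g(1) True by simp
      then show ?thesis using True by (intro bexI[of _ \<zero>]) auto
    next
      case False
      then have "{\<zero>} \<subset> L" using left_idealD(2)[OF L] by blast
      then obtain I where IL: "covers R I L" using ex_covers_below[OF left_ideal_zero L] by blast
      note I = coversD(1)[OF IL]
      have sub: "\<And>x. x \<in> I \<Longrightarrow> x \<in> L" using coversD(3)[OF IL] by blast
      have "\<exists>b\<in>carrier R. \<forall>x\<in>I. g x = x \<otimes> b"
        by (rule less.hyps[OF composition_length_less[OF I L coversD(3)[OF IL]] I]) (use g sub in auto)
      then obtain b where b: "b \<in> carrier R" "\<And>x. x \<in> I \<Longrightarrow> g x = x \<otimes> b" by blast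
      obtain u where u: "u \<in> L" "u \<notin> I" using coversD(3)[OF IL] by blast
      have uc: "u \<in> carrier R" using u Lc by blast
      let ?m = "colon R I u"
      have m: "max_left_ideal R ?m" by (rule covers_colon[OF IL u])
      have "rann R L \<subset> rann R I"
        using rann_antimono[of I L] rann_covers_neq[OF minR minL IL] coversD(3)[OF IL] by blast
      then obtain r where r: "r \<in> rann R I" "r \<notin> rann R L" by blast
      have rc: "r \<in> carrier R" using r by (simp add: rann_def)
      have "\<exists>x\<in>L. x \<otimes> r \<noteq> \<zero>" using r rc by (auto simp: rann_def)
      then obtain x where x: "x \<in> L" "x \<otimes> r \<noteq> \<zero>" by blast
      have ur: "u \<otimes> r \<noteq> \<zero>"
      proof
        assume 0: "u \<otimes> r = \<zero>"
        obtain a where a: "a \<in> carrier R" "x \<ominus> a \<otimes> u \<in> I" using covers_elem[OF IL u x(1)] by blast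
        have "(x \<ominus> a \<otimes> u) \<otimes> r = \<zero>" using r(1) a(2) by (simp add: rann_def)
        then show False using a x(2) Lc[OF x(1)] uc rc 0 by (simp add: l_distr_minus m_assoc)
      qed
      have urm: "u \<otimes> r \<in> rann R ?m"
        using r(1) uc by (auto simp: rann_def colon_def m_assoc[symmetric])
      let ?d = "g u \<ominus> u \<otimes> b"
      have dc: "?d \<in> carrier R" using g(1)[OF u(1)] uc b by simp
      have "a \<otimes> ?d = \<zero>" if a: "a \<in> ?m" for a
      proof -
        have a': "a \<in> carrier R" "a \<otimes> u \<in> I" using a by (auto simp: colon_def)
        have "a \<otimes> g u = a \<otimes> u \<otimes> b" using b(2)[OF a'(2)] g(3)[OF a'(1) u(1)] by simp
        then show ?thesis using a' uc b(1) g(1)[OF u(1)] by (simp add: r_distr_minus m_assoc)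
      qed
      then have "?d \<in> rann R ?m" using dc by (simp add: rann_def)
      then obtain s where s: "s \<in> carrier R" "?d \<ominus> u \<otimes> r \<otimes> s = \<zero>"
        using op.covers_elem[OF minR[OF m], of "u \<otimes> r" ?d] ur urm by auto
      have gu: "g u = u \<otimes> (b \<oplus> r \<otimes> s)"
      proof -
        have "?d = u \<otimes> r \<otimes> s" using s dc uc rc by simp
        then have "g u = u \<otimes> r \<otimes> s \<oplus> u \<otimes> b"
          using add_minus_cancel[of "g u" "u \<otimes> b"] g(1)[OF u(1)] uc b(1) by simp
        then show ?thesis using uc rc s(1) b(1) by (simp add: r_distr m_assoc a_comm)
      qed
      have bc: "b \<oplus> r \<otimes> s \<in> carrier R" using b rc s by simp
      have "g x = x \<otimes> (b \<oplus> r \<otimes> s)" if x: "x \<in> L" for x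
      proof -
        obtain a where a: "a \<in> carrier R" "x \<ominus> a \<otimes> u \<in> I" using covers_elem[OF IL u x] by blast
        have xc: "x \<in> carrier R" using Lc x by simp
        have au: "a \<otimes> u \<in> L" using left_idealD(4)[OF L a(1) u(1)] .
        have i: "x \<ominus> a \<otimes> u \<in> carrier R" using a xc uc by simp
        have ir: "(x \<ominus> a \<otimes> u) \<otimes> r = \<zero>" using r(1) a(2) by (simp add: rann_def)
        have "g x = g ((x \<ominus> a \<otimes> u) \<oplus> a \<otimes> u)" using add_minus_cancel xc a uc by simp
        also have "\<dots> = (x \<ominus> a \<otimes> u) \<otimes> b \<oplus> a \<otimes> (u \<otimes> (b \<oplus> r \<otimes> s))"
          using g(2)[OF sub[OF a(2)] au] b(2)[OF a(2)] g(3)[OF a(1) u(1)] gu by simp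
        also have "(x \<ominus> a \<otimes> u) \<otimes> b = (x \<ominus> a \<otimes> u) \<otimes> (b \<oplus> r \<otimes> s)"
          using i ir b rc s by (simp add: r_distr m_assoc[symmetric])
        also have "\<dots> \<oplus> a \<otimes> (u \<otimes> (b \<oplus> r \<otimes> s)) = ((x \<ominus> a \<otimes> u) \<oplus> a \<otimes> u) \<otimes> (b \<oplus> r \<otimes> s)"
          using i a uc bc by (simp add: l_distr m_assoc)
        also have "\<dots> = x \<otimes> (b \<oplus> r \<otimes> s)" using add_minus_cancel xc a uc by simp
        finally show ?thesis .
      qed
      then show ?thesis using bc by blast
    qed
  qed
qed

end

section \<open>Baer's criterion\<close>

lemma regular_module_simps [simp]:
  "carrier (regular_module R) = carrier R"
  "\<zero>\<^bsub>regular_module R\<^esub> = \<zero>\<^bsub>R\<^esub>"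
  "x \<oplus>\<^bsub>regular_module R\<^esub> y = x \<oplus>\<^bsub>R\<^esub> y"
  "a \<odot>\<^bsub>regular_module R\<^esub> x = a \<otimes>\<^bsub>R\<^esub> x"
  by (simp_all add: regular_module_def)

lemma (in ring) left_module_regular: "left_module R (regular_module R)"
proof -
  have "abelian_group (regular_module R)"
    by (rule abelian_groupI) (auto simp: a_ac intro: l_neg)
  then show ?thesis
    using ring_axioms
    by (auto simp: left_module_def left_module_axioms_def l_distr r_distr m_assoc)
qed

context left_module
begin

lemma smult_l_null: "x \<in> carrier M \<Longrightarrow> \<zero>\<^bsub>R\<^esub> \<odot>\<^bsub>M\<^esub> x = \<zero>\<^bsub>M\<^esub>"
  by (metis M.add.r_cancel_one' R.r_zero R.zero_closed smult_closed smult_l_distr)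

lemma smult_r_null: "a \<in> carrier R \<Longrightarrow> a \<odot>\<^bsub>M\<^esub> \<zero>\<^bsub>M\<^esub> = \<zero>\<^bsub>M\<^esub>"
  by (metis M.add.r_cancel_one' M.r_zero M.zero_closed smult_closed smult_r_distr)

lemma smult_l_minus: "a \<in> carrier R \<Longrightarrow> x \<in> carrier M \<Longrightarrow> (\<ominus>\<^bsub>R\<^esub> a) \<odot>\<^bsub>M\<^esub> x = \<ominus>\<^bsub>M\<^esub> (a \<odot>\<^bsub>M\<^esub> x)"
  using smult_l_distr[of "\<ominus>\<^bsub>R\<^esub> a" a x] smult_l_null[of x]
  by (simp add: R.l_neg smult_closed M.minus_equality[symmetric])

lemma smult_l_diff:
  assumes "a \<in> carrier R" "b \<in> carrier R" "x \<in> carrier M"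
  shows "(a \<ominus>\<^bsub>R\<^esub> b) \<odot>\<^bsub>M\<^esub> x = \<zero>\<^bsub>M\<^esub> \<longleftrightarrow> a \<odot>\<^bsub>M\<^esub> x = b \<odot>\<^bsub>M\<^esub> x"
proof -
  have "(a \<ominus>\<^bsub>R\<^esub> b) \<odot>\<^bsub>M\<^esub> x = a \<odot>\<^bsub>M\<^esub> x \<ominus>\<^bsub>M\<^esub> b \<odot>\<^bsub>M\<^esub> x"
    using assms by (simp add: a_minus_def smult_l_distr smult_l_minus)
  then show ?thesis using assms by (simp add: smult_closed)
qed

lemma submoduleI:
  assumes "H \<subseteq> carrier M" "\<zero>\<^bsub>M\<^esub> \<in> H"
    and "\<And>x y. x \<in> H \<Longrightarrow> y \<in> H \<Longrightarrow> x \<oplus>\<^bsub>M\<^esub> y \<in> H"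
    and smult: "\<And>a x. a \<in> carrier R \<Longrightarrow> x \<in> H \<Longrightarrow> a \<odot>\<^bsub>M\<^esub> x \<in> H"
  shows "Module.submodule H R M"
proof -
  have "\<ominus>\<^bsub>M\<^esub> x \<in> H" if x: "x \<in> H" for x
  proof -
    have xc: "x \<in> carrier M" using assms(1) x by blast
    have "(\<ominus>\<^bsub>R\<^esub> \<one>\<^bsub>R\<^esub>) \<odot>\<^bsub>M\<^esub> x \<in> H" using smult[OF _ x] by simp
    then show ?thesis using smult_l_minus[OF R.one_closed xc] smult_one[OF xc] by simp
  qed
  then have "subgroup H (add_monoid M)"
    using assms by (intro M.add.subgroupI) auto
  then show ?thesis using smult by (simp add: Module.submodule_def submodule_axioms_def)
qed

lemma submoduleD:
  assumes "Module.submodule H R M"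
  shows "x \<in> H \<Longrightarrow> x \<in> carrier M" "\<zero>\<^bsub>M\<^esub> \<in> H"
    "x \<in> H \<Longrightarrow> y \<in> H \<Longrightarrow> x \<oplus>\<^bsub>M\<^esub> y \<in> H"
    "a \<in> carrier R \<Longrightarrow> x \<in> H \<Longrightarrow> a \<odot>\<^bsub>M\<^esub> x \<in> H"
proof -
  interpret H: Module.submodule H R M by (fact assms)
  show "x \<in> H \<Longrightarrow> x \<in> carrier M" using H.subset by auto
  show "\<zero>\<^bsub>M\<^esub> \<in> H" using H.one_closed by simp
  show "x \<in> H \<Longrightarrow> y \<in> H \<Longrightarrow> x \<oplus>\<^bsub>M\<^esub> y \<in> H" using H.m_closed by simp
  show "a \<in> carrier R \<Longrightarrow> x \<in> H \<Longrightarrow> a \<odot>\<^bsub>M\<^esub> x \<in> H" by (rule H.smult_closed)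
qed

end

definition ann :: "('a, 'r) ring_scheme \<Rightarrow> ('a, 'b, 'm) module_scheme \<Rightarrow> 'b \<Rightarrow> 'a set" where
  "ann R M x = {a \<in> carrier R. a \<odot>\<^bsub>M\<^esub> x = \<zero>\<^bsub>M\<^esub>}"

text \<open>Graphs of homomorphisms from submodules of \<open>N\<close> to \<open>R\<close>.  By additivity, being single-valued need only be required at zero.
Graphs make unions of chains immediate.\<close>

definition partial_hom :: "('a, 'r) ring_scheme \<Rightarrow> ('a, 'b, 'm) module_scheme \<Rightarrow> ('b \<times> 'a) set \<Rightarrow> bool" where
  "partial_hom R N G \<longleftrightarrow> G \<subseteq> carrier N \<times> carrier R \<and> (\<zero>\<^bsub>N\<^esub>, \<zero>\<^bsub>R\<^esub>) \<in> G
     \<and> (\<forall>x b y c. (x, b) \<in> G \<longrightarrow> (y, c) \<in> G \<longrightarrow> (x \<oplus>\<^bsub>N\<^esub> y, b \<oplus>\<^bsub>R\<^esub> c) \<in> G)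
     \<and> (\<forall>a\<in>carrier R. \<forall>x b. (x, b) \<in> G \<longrightarrow> (a \<odot>\<^bsub>N\<^esub> x, a \<otimes>\<^bsub>R\<^esub> b) \<in> G)
     \<and> (\<forall>b. (\<zero>\<^bsub>N\<^esub>, b) \<in> G \<longrightarrow> b = \<zero>\<^bsub>R\<^esub>)"

lemma partial_homD:
  assumes "partial_hom R N G"
  shows "(x, b) \<in> G \<Longrightarrow> x \<in> carrier N" "(x, b) \<in> G \<Longrightarrow> b \<in> carrier R"
    "(\<zero>\<^bsub>N\<^esub>, \<zero>\<^bsub>R\<^esub>) \<in> G"
    "(x, b) \<in> G \<Longrightarrow> (y, c) \<in> G \<Longrightarrow> (x \<oplus>\<^bsub>N\<^esub> y, b \<oplus>\<^bsub>R\<^esub> c) \<in> G"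
    "a \<in> carrier R \<Longrightarrow> (x, b) \<in> G \<Longrightarrow> (a \<odot>\<^bsub>N\<^esub> x, a \<otimes>\<^bsub>R\<^esub> b) \<in> G"
    "(\<zero>\<^bsub>N\<^esub>, b) \<in> G \<Longrightarrow> b = \<zero>\<^bsub>R\<^esub>"
  using assms unfolding partial_hom_def by blast+

lemma partial_hom_unique:
  assumes N: "left_module R N" and G: "partial_hom R N G" and b: "(x, b) \<in> G" and c: "(x, c) \<in> G"
  shows "b = c"
proof -
  interpret N: left_module R N by (fact N)
  note PH = partial_homD[OF G]
  have x: "x \<in> carrier N" and bc: "b \<in> carrier R" "c \<in> carrier R" using PH(1,2) b c by auto
  have "((\<ominus>\<^bsub>R\<^esub> \<one>\<^bsub>R\<^esub>) \<odot>\<^bsub>N\<^esub> x, (\<ominus>\<^bsub>R\<^esub> \<one>\<^bsub>R\<^esub>) \<otimes>\<^bsub>R\<^esub> c) \<in> G" using PH(5)[OF _ c] by simp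
  then have "(\<ominus>\<^bsub>N\<^esub> x, \<ominus>\<^bsub>R\<^esub> c) \<in> G"
    using x bc by (simp add: N.smult_l_minus N.smult_one N.R.l_minus)
  from PH(4)[OF b this] have "(\<zero>\<^bsub>N\<^esub>, b \<ominus>\<^bsub>R\<^esub> c) \<in> G" using x by (simp add: N.M.r_neg a_minus_def)
  then have "b \<ominus>\<^bsub>R\<^esub> c = \<zero>\<^bsub>R\<^esub>" by (rule PH(6))
  then show ?thesis using bc by simp
qed

lemma partial_hom_Union:
  assumes ne: "C \<noteq> {}" and chain: "\<And>G H. G \<in> C \<Longrightarrow> H \<in> C \<Longrightarrow> G \<subseteq> H \<or> H \<subseteq> G"
    and ph: "\<And>G. G \<in> C \<Longrightarrow> partial_hom R N G"
  shows "partial_hom R N (\<Union>C)"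
  unfolding partial_hom_def
proof (intro conjI allI impI ballI)
  show "\<Union>C \<subseteq> carrier N \<times> carrier R"
    using ph unfolding partial_hom_def by (intro Union_least) blast
  show "(\<zero>\<^bsub>N\<^esub>, \<zero>\<^bsub>R\<^esub>) \<in> \<Union>C" using ne partial_homD(3)[OF ph] by blast
next
  fix x b y c assume "(x, b) \<in> \<Union>C" "(y, c) \<in> \<Union>C"
  then obtain G H where "G \<in> C" "H \<in> C" "(x, b) \<in> G" "(y, c) \<in> H" by blast
  then obtain K where "K \<in> C" "(x, b) \<in> K" "(y, c) \<in> K" using chain[of G H] by blast
  then show "(x \<oplus>\<^bsub>N\<^esub> y, b \<oplus>\<^bsub>R\<^esub> c) \<in> \<Union>C" using partial_homD(4)[OF ph] by blast
next
  fix a x b assume "a \<in> carrier R" "(x, b) \<in> \<Union>C"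
  then show "(a \<odot>\<^bsub>N\<^esub> x, a \<otimes>\<^bsub>R\<^esub> b) \<in> \<Union>C" using partial_homD(5)[OF ph] by blast
next
  fix b assume "(\<zero>\<^bsub>N\<^esub>, b) \<in> \<Union>C"
  then show "b = \<zero>\<^bsub>R\<^esub>" using partial_homD(6)[OF ph] by blast
qed

text \<open>The elements \<open>a\<close> with \<open>a y\<close> in the domain form a left ideal \<open>L\<close>, and \<open>a \<mapsto> a y\<close> followed by the partial homomorphism is right
multiplication by some \<open>b\<close> on \<open>L\<close>.  Then \<open>y \<mapsto> b\<close> is compatible with the given values.\<close>

lemma partial_hom_extend:
  assumes N: "left_module R N" and G: "partial_hom R N G" and y: "y \<in> carrier N"
    and ext: "\<And>L g. \<lbrakk>left_ideal R L; \<And>x. x \<in> L \<Longrightarrow> g x \<in> carrier R;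
        \<And>x y. x \<in> L \<Longrightarrow> y \<in> L \<Longrightarrow> g (x \<oplus>\<^bsub>R\<^esub> y) = g x \<oplus>\<^bsub>R\<^esub> g y;
        \<And>a x. a \<in> carrier R \<Longrightarrow> x \<in> L \<Longrightarrow> g (a \<otimes>\<^bsub>R\<^esub> x) = a \<otimes>\<^bsub>R\<^esub> g x\<rbrakk>
        \<Longrightarrow> \<exists>b\<in>carrier R. \<forall>x\<in>L. g x = x \<otimes>\<^bsub>R\<^esub> b"
  shows "\<exists>H b. partial_hom R N H \<and> G \<subseteq> H \<and> (y, b) \<in> H"
proof -
  interpret N: left_module R N by (fact N)
  note PH = partial_homD[OF G]
  define L where "L = {a \<in> carrier R. \<exists>q. (a \<odot>\<^bsub>N\<^esub> y, q) \<in> G}"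
  define g where "g a = (SOME q. (a \<odot>\<^bsub>N\<^esub> y, q) \<in> G)" for a
  have g: "(a \<odot>\<^bsub>N\<^esub> y, g a) \<in> G" if "a \<in> L" for a
  proof -
    have "\<exists>q. (a \<odot>\<^bsub>N\<^esub> y, q) \<in> G" using that by (simp add: L_def)
    then show ?thesis unfolding g_def by (rule someI_ex)
  qed
  have Lc: "a \<in> carrier R" if "a \<in> L" for a using that by (simp add: L_def)
  have inL: "a \<in> L" if "a \<in> carrier R" "(a \<odot>\<^bsub>N\<^esub> y, q) \<in> G" for a q
    using that unfolding L_def by blast
  have addG: "((a \<oplus>\<^bsub>R\<^esub> b) \<odot>\<^bsub>N\<^esub> y, p \<oplus>\<^bsub>R\<^esub> q) \<in> G"
    if "(a \<odot>\<^bsub>N\<^esub> y, p) \<in> G" "(b \<odot>\<^bsub>N\<^esub> y, q) \<in> G" "a \<in> carrier R" "b \<in> carrier R" for a b p q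
    using PH(4)[OF that(1,2)] that(3,4) y by (simp add: N.smult_l_distr)
  have mulG: "((a \<otimes>\<^bsub>R\<^esub> b) \<odot>\<^bsub>N\<^esub> y, a \<otimes>\<^bsub>R\<^esub> q) \<in> G"
    if "(b \<odot>\<^bsub>N\<^esub> y, q) \<in> G" "a \<in> carrier R" "b \<in> carrier R" for a b q
    using PH(5)[OF that(2,1)] that(2,3) y by (simp add: N.smult_assoc)
  have LI: "left_ideal R L"
    unfolding left_ideal_def
  proof (intro conjI ballI)
    show "L \<subseteq> carrier R" using Lc by blast
    have "(\<zero>\<^bsub>R\<^esub> \<odot>\<^bsub>N\<^esub> y, \<zero>\<^bsub>R\<^esub>) \<in> G" using PH(3) y by (simp add: N.smult_l_null)
    then show "\<zero>\<^bsub>R\<^esub> \<in> L" unfolding L_def by blast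
    fix a assume a: "a \<in> L"
    { fix b assume b: "b \<in> L"
      show "a \<oplus>\<^bsub>R\<^esub> b \<in> L" 
        using inL[OF _ addG[OF g[OF a] g[OF b] Lc[OF a] Lc[OF b]]] Lc[OF a] Lc[OF b] by simp }
    { fix b assume b: "b \<in> carrier R"
      show "b \<otimes>\<^bsub>R\<^esub> a \<in> L" 
        using inL[OF _ mulG[OF g[OF a] b Lc[OF a]]] Lc[OF a] b by simp }
  qed
  have "\<exists>b\<in>carrier R. \<forall>x\<in>L. g x = x \<otimes>\<^bsub>R\<^esub> b"
  proof (rule ext[OF LI])
    fix a assume a: "a \<in> L"
    show "g a \<in> carrier R" by (rule PH(2)[OF g[OF a]])
    { fix b assume b: "b \<in> L"
      have "a \<oplus>\<^bsub>R\<^esub> b \<in> L" using LI a b by (auto simp: left_ideal_def)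
      then show "g (a \<oplus>\<^bsub>R\<^esub> b) = g a \<oplus>\<^bsub>R\<^esub> g b"
        using partial_hom_unique[OF N G g addG[OF g[OF a] g[OF b] Lc[OF a] Lc[OF b]]] by simp }
    { fix b assume b: "b \<in> carrier R"
      have "b \<otimes>\<^bsub>R\<^esub> a \<in> L" using LI a b by (auto simp: left_ideal_def)
      then show "g (b \<otimes>\<^bsub>R\<^esub> a) = b \<otimes>\<^bsub>R\<^esub> g a"
        using partial_hom_unique[OF N G g mulG[OF g[OF a] b Lc[OF a]]] by simp }
  qed
  then obtain b where b: "b \<in> carrier R" "\<And>a. a \<in> L \<Longrightarrow> g a = a \<otimes>\<^bsub>R\<^esub> b" by blast
  have key: "q = a \<otimes>\<^bsub>R\<^esub> b" if "a \<in> carrier R" "(a \<odot>\<^bsub>N\<^esub> y, q) \<in> G" for a q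
  proof -
    have a: "a \<in> L" by (rule inL[OF that])
    show ?thesis using partial_hom_unique[OF N G that(2) g[OF a]] b(2)[OF a] by simp
  qed
  define H where "H = {(p \<oplus>\<^bsub>N\<^esub> a \<odot>\<^bsub>N\<^esub> y, q \<oplus>\<^bsub>R\<^esub> a \<otimes>\<^bsub>R\<^esub> b) | p q a. (p, q) \<in> G \<and> a \<in> carrier R}"
  have HI: "(p \<oplus>\<^bsub>N\<^esub> a \<odot>\<^bsub>N\<^esub> y, q \<oplus>\<^bsub>R\<^esub> a \<otimes>\<^bsub>R\<^esub> b) \<in> H" if "(p, q) \<in> G" "a \<in> carrier R" for p q a
    using that unfolding H_def by blast
  have GH: "(p, q) \<in> H" if "(p, q) \<in> G" for p q
    using HI[OF that N.R.zero_closed] PH(1,2)[OF that] y b(1) by (simp add: N.smult_l_null)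
  have "(\<zero>\<^bsub>N\<^esub> \<oplus>\<^bsub>N\<^esub> \<one>\<^bsub>R\<^esub> \<odot>\<^bsub>N\<^esub> y, \<zero>\<^bsub>R\<^esub> \<oplus>\<^bsub>R\<^esub> \<one>\<^bsub>R\<^esub> \<otimes>\<^bsub>R\<^esub> b) \<in> H" by (rule HI[OF PH(3) N.R.one_closed])
  then have yH: "(y, b) \<in> H" using y b(1) by (simp add: N.smult_one)
  have "partial_hom R N H"
    unfolding partial_hom_def
  proof (intro conjI allI impI ballI)
    show "H \<subseteq> carrier N \<times> carrier R"
      unfolding H_def using PH(1,2) y b(1) by (auto intro!: N.M.a_closed N.smult_closed)
    show "(\<zero>\<^bsub>N\<^esub>, \<zero>\<^bsub>R\<^esub>) \<in> H" by (rule GH[OF PH(3)])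
  next
    fix x c x' c' assume "(x, c) \<in> H" "(x', c') \<in> H"
    then obtain p q a p' q' a' where
      1: "x = p \<oplus>\<^bsub>N\<^esub> a \<odot>\<^bsub>N\<^esub> y" "c = q \<oplus>\<^bsub>R\<^esub> a \<otimes>\<^bsub>R\<^esub> b" "(p, q) \<in> G" "a \<in> carrier R" and
      2: "x' = p' \<oplus>\<^bsub>N\<^esub> a' \<odot>\<^bsub>N\<^esub> y" "c' = q' \<oplus>\<^bsub>R\<^esub> a' \<otimes>\<^bsub>R\<^esub> b" "(p', q') \<in> G" "a' \<in> carrier R"
      unfolding H_def by blast
    note cc = PH(1,2)[OF 1(3)] PH(1,2)[OF 2(3)]
    have "x \<oplus>\<^bsub>N\<^esub> x' = (p \<oplus>\<^bsub>N\<^esub> p') \<oplus>\<^bsub>N\<^esub> (a \<oplus>\<^bsub>R\<^esub> a') \<odot>\<^bsub>N\<^esub> y"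
      using 1(1,4) 2(1,4) cc y by (simp add: N.smult_l_distr N.smult_closed N.M.a_ac)
    moreover have "c \<oplus>\<^bsub>R\<^esub> c' = (q \<oplus>\<^bsub>R\<^esub> q') \<oplus>\<^bsub>R\<^esub> (a \<oplus>\<^bsub>R\<^esub> a') \<otimes>\<^bsub>R\<^esub> b"
      using 1(2,4) 2(2,4) cc b(1) by (simp add: N.R.l_distr N.R.a_ac)
    ultimately show "(x \<oplus>\<^bsub>N\<^esub> x', c \<oplus>\<^bsub>R\<^esub> c') \<in> H"
      using HI[OF PH(4)[OF 1(3) 2(3)], of "a \<oplus>\<^bsub>R\<^esub> a'"] 1(4) 2(4) by simp
  next
    fix r x c assume r: "r \<in> carrier R" and "(x, c) \<in> H"
    then obtain p q a where
      1: "x = p \<oplus>\<^bsub>N\<^esub> a \<odot>\<^bsub>N\<^esub> y" "c = q \<oplus>\<^bsub>R\<^esub> a \<otimes>\<^bsub>R\<^esub> b" "(p, q) \<in> G" "a \<in> carrier R"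
      unfolding H_def by blast
    note cc = PH(1,2)[OF 1(3)]
    have "r \<odot>\<^bsub>N\<^esub> x = r \<odot>\<^bsub>N\<^esub> p \<oplus>\<^bsub>N\<^esub> (r \<otimes>\<^bsub>R\<^esub> a) \<odot>\<^bsub>N\<^esub> y"
      using 1(1,4) cc y r by (simp add: N.smult_r_distr N.smult_closed N.smult_assoc)
    moreover have "r \<otimes>\<^bsub>R\<^esub> c = r \<otimes>\<^bsub>R\<^esub> q \<oplus>\<^bsub>R\<^esub> (r \<otimes>\<^bsub>R\<^esub> a) \<otimes>\<^bsub>R\<^esub> b"
      using 1(2,4) cc b(1) r by (simp add: N.R.r_distr N.R.m_assoc)
    ultimately show "(r \<odot>\<^bsub>N\<^esub> x, r \<otimes>\<^bsub>R\<^esub> c) \<in> H"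
      using HI[OF PH(5)[OF r 1(3)], of "r \<otimes>\<^bsub>R\<^esub> a"] 1(4) r by simp
  next
    fix c assume "(\<zero>\<^bsub>N\<^esub>, c) \<in> H"
    then obtain p q a where
      1: "\<zero>\<^bsub>N\<^esub> = p \<oplus>\<^bsub>N\<^esub> a \<odot>\<^bsub>N\<^esub> y" "c = q \<oplus>\<^bsub>R\<^esub> a \<otimes>\<^bsub>R\<^esub> b" "(p, q) \<in> G" "a \<in> carrier R"
      unfolding H_def by blast
    note cc = PH(1,2)[OF 1(3)]
    have "p = (\<ominus>\<^bsub>R\<^esub> a) \<odot>\<^bsub>N\<^esub> y"
      using 1(1,4) cc y N.M.minus_equality[of p "a \<odot>\<^bsub>N\<^esub> y"] by (simp add: N.smult_l_minus N.smult_closed)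
    then have "q = (\<ominus>\<^bsub>R\<^esub> a) \<otimes>\<^bsub>R\<^esub> b" using key[of "\<ominus>\<^bsub>R\<^esub> a" q] 1(3,4) by simp
    then show "c = \<zero>\<^bsub>R\<^esub>" using 1(2,4) b(1) by (simp add: N.R.l_minus N.R.l_neg)
  qed
  then show ?thesis using GH yH by auto
qed

text \<open>Extend \<open>g\<close>, regarded as a partial homomorphism on the image of \<open>i\<close>, to a maximal one by Zorn's lemma;
by \<open>partial_hom_extend\<close> it is defined on all of \<open>N\<close>.\<close>

theorem (in ring) baer_criterion:
  assumes ext: "\<And>L g. \<lbrakk>left_ideal R L; \<And>x. x \<in> L \<Longrightarrow> g x \<in> carrier R;
        \<And>x y. x \<in> L \<Longrightarrow> y \<in> L \<Longrightarrow> g (x \<oplus> y) = g x \<oplus> g y;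
        \<And>a x. a \<in> carrier R \<Longrightarrow> x \<in> L \<Longrightarrow> g (a \<otimes> x) = a \<otimes> g x\<rbrakk>
        \<Longrightarrow> \<exists>b\<in>carrier R. \<forall>x\<in>L. g x = x \<otimes> b"
  shows "self_injective TYPE('x) R"
  unfolding injective_module_def
proof (intro conjI allI impI ballI)
  show "left_module R (regular_module R)" by (rule left_module_regular)
  fix M N :: "('a, 'x) module" and i g
  assume MN: "left_module R M \<and> left_module R N"
    and i: "i \<in> left_module_hom R M N" and g: "g \<in> left_module_hom R M (regular_module R)"
    and inj: "inj_on i (carrier M)"
  interpret M: left_module R M using MN by blast
  interpret N: left_module R N using MN by blast
  have N: "left_module R N" using MN by blast
  have ic: "\<And>x. x \<in> carrier M \<Longrightarrow> i x \<in> carrier N"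
    and ia: "\<And>x y. x \<in> carrier M \<Longrightarrow> y \<in> carrier M \<Longrightarrow> i (x \<oplus>\<^bsub>M\<^esub> y) = i x \<oplus>\<^bsub>N\<^esub> i y"
    and im: "\<And>a x. a \<in> carrier R \<Longrightarrow> x \<in> carrier M \<Longrightarrow> i (a \<odot>\<^bsub>M\<^esub> x) = a \<odot>\<^bsub>N\<^esub> i x"
    using i by (auto simp: left_module_hom_def)
  have gc: "\<And>x. x \<in> carrier M \<Longrightarrow> g x \<in> carrier R"
    and ga: "\<And>x y. x \<in> carrier M \<Longrightarrow> y \<in> carrier M \<Longrightarrow> g (x \<oplus>\<^bsub>M\<^esub> y) = g x \<oplus> g y"
    and gm: "\<And>a x. a \<in> carrier R \<Longrightarrow> x \<in> carrier M \<Longrightarrow> g (a \<odot>\<^bsub>M\<^esub> x) = a \<otimes> g x"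
    using g by (auto simp: left_module_hom_def)
  have i0: "i \<zero>\<^bsub>M\<^esub> = \<zero>\<^bsub>N\<^esub>"
    using im[of \<zero> "\<zero>\<^bsub>M\<^esub>"] ic[of "\<zero>\<^bsub>M\<^esub>"] by (simp add: M.smult_l_null N.smult_l_null)
  have g0: "g \<zero>\<^bsub>M\<^esub> = \<zero>"
    using gm[of \<zero> "\<zero>\<^bsub>M\<^esub>"] gc[of "\<zero>\<^bsub>M\<^esub>"] by (simp add: M.smult_l_null)
  define G0 where "G0 = (\<lambda>x. (i x, g x)) ` carrier M"
  have G0: "partial_hom R N G0"
    unfolding partial_hom_def
  proof (intro conjI allI impI ballI)
    show "G0 \<subseteq> carrier N \<times> carrier R" using ic gc by (auto simp: G0_def)
    have "(i \<zero>\<^bsub>M\<^esub>, g \<zero>\<^bsub>M\<^esub>) \<in> G0" unfolding G0_def by blast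
    then show "(\<zero>\<^bsub>N\<^esub>, \<zero>) \<in> G0" by (simp add: i0 g0)
  next
    fix x b y c assume "(x, b) \<in> G0" "(y, c) \<in> G0"
    then obtain p q where "p \<in> carrier M" "q \<in> carrier M" "x = i p" "b = g p" "y = i q" "c = g q"
      by (auto simp: G0_def)
    then show "(x \<oplus>\<^bsub>N\<^esub> y, b \<oplus> c) \<in> G0"
      unfolding G0_def by (intro image_eqI[of _ _ "p \<oplus>\<^bsub>M\<^esub> q"]) (simp_all add: ia ga)
  next
    fix a x b assume a: "a \<in> carrier R" and "(x, b) \<in> G0"
    then obtain p where "p \<in> carrier M" "x = i p" "b = g p" by (auto simp: G0_def)
    then show "(a \<odot>\<^bsub>N\<^esub> x, a \<otimes> b) \<in> G0"
      unfolding G0_def using a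
      by (intro image_eqI[of _ _ "a \<odot>\<^bsub>M\<^esub> p"]) (simp_all add: im gm M.smult_closed)
  next
    fix b assume "(\<zero>\<^bsub>N\<^esub>, b) \<in> G0"
    then obtain p where p: "p \<in> carrier M" "\<zero>\<^bsub>N\<^esub> = i p" "b = g p" by (auto simp: G0_def)
    have "p = \<zero>\<^bsub>M\<^esub>" by (rule inj_onD[OF inj]) (use p i0 in auto)
    then show "b = \<zero>" using p g0 by simp
  qed
  let ?P = "{G. partial_hom R N G \<and> G0 \<subseteq> G}"
  have "\<exists>G\<in>?P. \<forall>H\<in>?P. G \<subseteq> H \<longrightarrow> H = G"
  proof (rule subset_Zorn_nonempty)
    show "?P \<noteq> {}" using G0 by blast
    fix C assume C: "C \<noteq> {}" "subset.chain ?P C"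
    have CP: "C \<subseteq> ?P" and ch: "\<And>G H. G \<in> C \<Longrightarrow> H \<in> C \<Longrightarrow> G \<subseteq> H \<or> H \<subseteq> G"
      using C(2) by (auto simp: subset_chain_def)
    have "partial_hom R N (\<Union>C)" by (rule partial_hom_Union[OF C(1) ch]) (use CP in auto)
    moreover have "G0 \<subseteq> \<Union>C" using C(1) CP by blast
    ultimately show "\<Union>C \<in> ?P" by blast
  qed
  then obtain G where GP: "G \<in> ?P" and GM: "\<forall>H\<in>?P. G \<subseteq> H \<longrightarrow> H = G" by (elim bexE)
  have G: "partial_hom R N G" "G0 \<subseteq> G" using GP by simp_all
  have max: "H = G" if "partial_hom R N H" "G \<subseteq> H" for H
    using GM that subset_trans[OF G(2) that(2)] by simp
  have total: "\<exists>b. (y, b) \<in> G" if y: "y \<in> carrier N" for y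
  proof -
    have "\<exists>H b. partial_hom R N H \<and> G \<subseteq> H \<and> (y, b) \<in> H"
    proof (rule partial_hom_extend[OF N G(1) y])
      fix L g
      assume 1: "left_ideal R L" and 2: "\<And>x. x \<in> L \<Longrightarrow> g x \<in> carrier R"
        and 3: "\<And>x y. x \<in> L \<Longrightarrow> y \<in> L \<Longrightarrow> g (x \<oplus> y) = g x \<oplus> g y"
        and 4: "\<And>a x. a \<in> carrier R \<Longrightarrow> x \<in> L \<Longrightarrow> g (a \<otimes> x) = a \<otimes> g x"
      show "\<exists>b\<in>carrier R. \<forall>x\<in>L. g x = x \<otimes> b" by (rule ext[OF 1 2 3 4])
    qed
    then obtain H b where H: "partial_hom R N H" "G \<subseteq> H" "(y, b) \<in> H" by blast
    then show ?thesis using max[OF H(1,2)] by blast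
  qed
  define h where "h y = (SOME b. (y, b) \<in> G)" for y
  have h: "(y, h y) \<in> G" if "y \<in> carrier N" for y
    unfolding h_def by (rule someI_ex[OF total[OF that]])
  note PH = partial_homD[OF G(1)] and uniq = partial_hom_unique[OF N G(1)]
  have "h \<in> left_module_hom R N (regular_module R)"
    unfolding left_module_hom_def
  proof (intro CollectI conjI ballI)
    show "h \<in> carrier N \<rightarrow> carrier (regular_module R)" using PH(2) h by auto
    fix x y assume "x \<in> carrier N" "y \<in> carrier N"
    then show "h (x \<oplus>\<^bsub>N\<^esub> y) = h x \<oplus>\<^bsub>regular_module R\<^esub> h y"
      using uniq[OF h PH(4)[OF h h], of x y] by simp
  next
    fix a x assume "a \<in> carrier R" "x \<in> carrier N"
    then show "h (a \<odot>\<^bsub>N\<^esub> x) = a \<odot>\<^bsub>regular_module R\<^esub> h x"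
      using uniq[OF h PH(5)[OF _ h], of a x] by (simp add: N.smult_closed)
  qed
  moreover have "h (i x) = g x" if x: "x \<in> carrier M" for x
  proof -
    have "(i x, g x) \<in> G" using G(2) x by (auto simp: G0_def)
    then show ?thesis using uniq[OF h[OF ic[OF x]]] by blast
  qed
  ultimately show "\<exists>h\<in>left_module_hom R N (regular_module R). \<forall>x\<in>carrier M. h (i x) = g x" by blast
qed

section \<open>Simple modules as quotients by maximal left ideals\<close>

lemma dual_module_simps [simp]:
  "\<zero>\<^bsub>dual_module R M\<^esub> = (\<lambda>x \<in> carrier M. \<zero>\<^bsub>R\<^esub>)"
  "f \<oplus>\<^bsub>dual_module R M\<^esub> g = (\<lambda>x \<in> carrier M. f x \<oplus>\<^bsub>R\<^esub> g x)"
  "a \<odot>\<^bsub>dual_module R M\<^esub> f = (\<lambda>x \<in> carrier M. f x \<otimes>\<^bsub>R\<^esub> a)"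
  by (simp_all add: dual_module_def)

lemma dual_moduleD:
  assumes "f \<in> carrier (dual_module R M)"
  shows "x \<in> carrier M \<Longrightarrow> f x \<in> carrier R"
    "x \<in> carrier M \<Longrightarrow> y \<in> carrier M \<Longrightarrow> f (x \<oplus>\<^bsub>M\<^esub> y) = f x \<oplus>\<^bsub>R\<^esub> f y"
    "a \<in> carrier R \<Longrightarrow> x \<in> carrier M \<Longrightarrow> f (a \<odot>\<^bsub>M\<^esub> x) = a \<otimes>\<^bsub>R\<^esub> f x"
    "f \<in> extensional (carrier M)"
  using assms by (auto simp: dual_module_def left_module_hom_def)

lemma dual_moduleI:
  assumes "\<And>x. x \<in> carrier M \<Longrightarrow> f x \<in> carrier R"
    "\<And>x y. x \<in> carrier M \<Longrightarrow> y \<in> carrier M \<Longrightarrow> f (x \<oplus>\<^bsub>M\<^esub> y) = f x \<oplus>\<^bsub>R\<^esub> f y"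
    "\<And>a x. a \<in> carrier R \<Longrightarrow> x \<in> carrier M \<Longrightarrow> f (a \<odot>\<^bsub>M\<^esub> x) = a \<otimes>\<^bsub>R\<^esub> f x"
    "f \<in> extensional (carrier M)"
  shows "f \<in> carrier (dual_module R M)"
  using assms by (auto simp: dual_module_def left_module_hom_def)

text \<open>A simple module with a chosen generator \<open>s\<close>, hence with a chosen isomorphism from \<open>R / m\<close>, where \<open>m\<close> is the annihilator of
\<open>s\<close>.\<close>

locale simple_left_module = left_module R M
  for R :: "('a, 'r) ring_scheme" and M :: "('a, 'b, 'm) module_scheme" +
  fixes s :: 'b
  assumes simple: "simple_module R M" and s: "s \<in> carrier M" "s \<noteq> \<zero>\<^bsub>M\<^esub>"
begin

abbreviation "m \<equiv> ann R M s"

lemma generates: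
  assumes "y \<in> carrier M"
  shows "\<exists>a\<in>carrier R. y = a \<odot>\<^bsub>M\<^esub> s"
proof -
  let ?H = "(\<lambda>a. a \<odot>\<^bsub>M\<^esub> s) ` carrier R"
  have "Module.submodule ?H R M"
  proof (rule submoduleI)
    show "?H \<subseteq> carrier M" using s by (auto simp: smult_closed)
    show "\<zero>\<^bsub>M\<^esub> \<in> ?H" using smult_l_null[OF s(1)] by (metis R.zero_closed image_eqI)
    show "x \<oplus>\<^bsub>M\<^esub> y \<in> ?H" if "x \<in> ?H" "y \<in> ?H" for x y
      using that s by (auto simp: smult_l_distr[symmetric])
    show "a \<odot>\<^bsub>M\<^esub> x \<in> ?H" if "a \<in> carrier R" "x \<in> ?H" for a x
      using that s by (auto simp: smult_assoc[symmetric])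
  qed
  then have "?H = {\<zero>\<^bsub>M\<^esub>} \<or> ?H = carrier M" using simple by (simp add: simple_module_def)
  moreover have "s \<in> ?H" using smult_one[OF s(1)] by (metis R.one_closed image_eqI)
  ultimately show ?thesis using s assms by auto
qed

lemma left_ideal_ann: "left_ideal R m"
  using s unfolding left_ideal_def ann_def
  by (auto simp: smult_l_null smult_l_distr smult_assoc smult_r_null)

lemma max_ann: "max_left_ideal R m"
proof (rule R.coversI[OF left_ideal_ann R.left_ideal_carrier])
  have "\<one>\<^bsub>R\<^esub> \<notin> m" using s smult_one by (simp add: ann_def)
  then show "m \<subset> carrier R" by (auto simp: ann_def)
  fix z x assume z: "z \<in> carrier R" "z \<notin> m" and x: "x \<in> carrier R"
  have t: "z \<odot>\<^bsub>M\<^esub> s \<in> carrier M" "z \<odot>\<^bsub>M\<^esub> s \<noteq> \<zero>\<^bsub>M\<^esub>"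
    using z s by (auto simp: ann_def smult_closed)
  interpret t: simple_left_module R M "z \<odot>\<^bsub>M\<^esub> s"
    by unfold_locales (use simple t in auto)
  obtain a where a: "a \<in> carrier R" "x \<odot>\<^bsub>M\<^esub> s = a \<odot>\<^bsub>M\<^esub> (z \<odot>\<^bsub>M\<^esub> s)"
    using t.generates[of "x \<odot>\<^bsub>M\<^esub> s"] smult_closed[OF x s(1)] by blast
  then have "(x \<ominus>\<^bsub>R\<^esub> a \<otimes>\<^bsub>R\<^esub> z) \<odot>\<^bsub>M\<^esub> s = \<zero>\<^bsub>M\<^esub>"
    using smult_l_diff[of x "a \<otimes>\<^bsub>R\<^esub> z" s] x z s by (simp add: smult_assoc)
  then show "\<exists>a\<in>carrier R. x \<ominus>\<^bsub>R\<^esub> a \<otimes>\<^bsub>R\<^esub> z \<in> m"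
    using a x z by (auto simp: ann_def)
qed

text \<open>The functional on \<open>M\<close> that takes the value \<open>x\<close> at \<open>s\<close>; it is well defined if \<open>m\<close> annihilates \<open>x\<close>.\<close>

definition functional_at :: "'a \<Rightarrow> 'b \<Rightarrow> 'a" where
  "functional_at x = (\<lambda>y\<in>carrier M. (SOME a. a \<in> carrier R \<and> a \<odot>\<^bsub>M\<^esub> s = y) \<otimes>\<^bsub>R\<^esub> x)"

lemma functional_at_smult:
  assumes x: "x \<in> rann R m" and a: "a \<in> carrier R"
  shows "functional_at x (a \<odot>\<^bsub>M\<^esub> s) = a \<otimes>\<^bsub>R\<^esub> x"
proof -
  have xc: "x \<in> carrier R" using x by (simp add: rann_def)
  let ?b = "SOME b. b \<in> carrier R \<and> b \<odot>\<^bsub>M\<^esub> s = a \<odot>\<^bsub>M\<^esub> s"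
  have b: "?b \<in> carrier R \<and> ?b \<odot>\<^bsub>M\<^esub> s = a \<odot>\<^bsub>M\<^esub> s"
    by (rule someI[of _ a]) (use a in simp)
  then have "?b \<ominus>\<^bsub>R\<^esub> a \<in> m" using smult_l_diff[of ?b a s] a s by (simp add: ann_def)
  then have "(?b \<ominus>\<^bsub>R\<^esub> a) \<otimes>\<^bsub>R\<^esub> x = \<zero>\<^bsub>R\<^esub>" using x by (simp add: rann_def)
  then have "?b \<otimes>\<^bsub>R\<^esub> x = a \<otimes>\<^bsub>R\<^esub> x" using b a xc by (simp add: R.l_distr_minus)
  then show ?thesis unfolding functional_at_def using smult_closed[OF a s(1)] by simp
qed

lemma functional_at_in_dual:
  assumes x: "x \<in> rann R m"
  shows "functional_at x \<in> carrier (dual_module R M)"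
proof (rule dual_moduleI)
  have xc: "x \<in> carrier R" using x by (simp add: rann_def)
  show "functional_at x \<in> extensional (carrier M)" by (simp add: functional_at_def)
  fix y assume "y \<in> carrier M"
  then obtain a where a: "a \<in> carrier R" "y = a \<odot>\<^bsub>M\<^esub> s" using generates by blast
  show "functional_at x y \<in> carrier R" using functional_at_smult[OF x] a xc by simp
  { fix z assume "z \<in> carrier M"
    then obtain b where b: "b \<in> carrier R" "z = b \<odot>\<^bsub>M\<^esub> s" using generates by blast
    have "y \<oplus>\<^bsub>M\<^esub> z = (a \<oplus>\<^bsub>R\<^esub> b) \<odot>\<^bsub>M\<^esub> s" using a b s by (simp add: smult_l_distr)
    then show "functional_at x (y \<oplus>\<^bsub>M\<^esub> z) = functional_at x y \<oplus>\<^bsub>R\<^esub> functional_at x z"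
      using functional_at_smult[OF x] a b xc by (simp add: R.l_distr) }
  { fix b assume b: "b \<in> carrier R"
    have "b \<odot>\<^bsub>M\<^esub> y = (b \<otimes>\<^bsub>R\<^esub> a) \<odot>\<^bsub>M\<^esub> s" using a b s by (simp add: smult_assoc)
    then show "functional_at x (b \<odot>\<^bsub>M\<^esub> y) = b \<otimes>\<^bsub>R\<^esub> functional_at x y"
      using functional_at_smult[OF x] a b xc by (simp add: R.m_assoc) }
qed

lemma functional_at_generator: "x \<in> rann R m \<Longrightarrow> functional_at x s = x"
  using functional_at_smult[of x "\<one>\<^bsub>R\<^esub>"] s by (simp add: smult_one rann_def)

lemma dual_apply: "f \<in> carrier (dual_module R M) \<Longrightarrow> a \<in> carrier R \<Longrightarrow> f (a \<odot>\<^bsub>M\<^esub> s) = a \<otimes>\<^bsub>R\<^esub> f s"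
  by (rule dual_moduleD(3)[OF _ _ s(1)])

lemma dual_apply_s:
  assumes f: "f \<in> carrier (dual_module R M)"
  shows "f s \<in> rann R m"
proof -
  have "f \<zero>\<^bsub>M\<^esub> = \<zero>\<^bsub>R\<^esub>"
    using dual_apply[OF f, of "\<zero>\<^bsub>R\<^esub>"] dual_moduleD(1)[OF f s(1)] s by (simp add: smult_l_null)
  then have "a \<otimes>\<^bsub>R\<^esub> f s = \<zero>\<^bsub>R\<^esub>" if "a \<in> m" for a
    using that dual_apply[OF f, of a] by (simp add: ann_def)
  then show ?thesis using dual_moduleD(1)[OF f s(1)] by (simp add: rann_def)
qed

lemma dual_eqI:
  assumes f: "f \<in> carrier (dual_module R M)" and g: "g \<in> carrier (dual_module R M)" and "f s = g s"
  shows "f = g"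
proof (rule extensionalityI[OF dual_moduleD(4)[OF f] dual_moduleD(4)[OF g]])
  fix x assume "x \<in> carrier M"
  then obtain a where "a \<in> carrier R" "x = a \<odot>\<^bsub>M\<^esub> s" using generates by blast
  then show "f x = g x" using dual_apply[OF f] dual_apply[OF g] assms(3) by simp
qed

text \<open>Evaluation at \<open>s\<close> is an isomorphism from the dual module onto \<open>rann R m\<close>, with inverse \<open>functional_at\<close>; it
matches submodules with right ideals.\<close>

lemma simple_dual_iff:
  "simple_module (opposite_ring R) (dual_module R M) \<longleftrightarrow> min_right_ideal R (rann R m)"
proof
  let ?op = "opposite_ring R" and ?D = "dual_module R M"
  interpret D: left_module ?op ?D by (rule dual_module_is_right_module[OF left_module_axioms])
  have mc: "m \<subseteq> carrier R" by (auto simp: ann_def)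
  have UI: "right_ideal R (rann R m)" by (rule R.right_ideal_rann[OF mc])
  have D_zero: "f = \<zero>\<^bsub>?D\<^esub>" if "f \<in> carrier ?D" "f s = \<zero>\<^bsub>R\<^esub>" for f
    by (rule dual_eqI[OF that(1) D.M.zero_closed]) (use that s in simp)
  {
    assume L: "simple_module ?op ?D"
    show "min_right_ideal R (rann R m)"
      unfolding covers_def
    proof (intro conjI allI impI)
      show "right_ideal R {\<zero>\<^bsub>?op\<^esub>}" by (rule D.R.left_ideal_zero)
      show "right_ideal R (rann R m)" by (rule UI)
      have "rann R m \<noteq> {\<zero>\<^bsub>R\<^esub>}"
      proof
        assume "rann R m = {\<zero>\<^bsub>R\<^esub>}"
        then have "carrier ?D = {\<zero>\<^bsub>?D\<^esub>}"
          using D_zero dual_apply_s D.M.zero_closed by blast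
        then show False using L by (simp add: simple_module_def)
      qed
      then show "{\<zero>\<^bsub>?op\<^esub>} \<subset> rann R m" using D.R.left_idealD(2)[OF UI] by auto
      fix Z assume Z: "right_ideal R Z" "{\<zero>\<^bsub>?op\<^esub>} \<subseteq> Z" "Z \<subseteq> rann R m"
      let ?H = "{f \<in> carrier ?D. f s \<in> Z}"
      have "Module.submodule ?H ?op ?D"
      proof (rule D.submoduleI)
        show "\<zero>\<^bsub>?D\<^esub> \<in> ?H" using D.M.zero_closed Z(2) s by auto
        show "f \<oplus>\<^bsub>?D\<^esub> g \<in> ?H" if "f \<in> ?H" "g \<in> ?H" for f g
          using that D.M.a_closed[of f g] D.R.left_idealD(3)[OF Z(1), of "f s" "g s"] s by auto
        show "a \<odot>\<^bsub>?D\<^esub> f \<in> ?H" if "a \<in> carrier ?op" "f \<in> ?H" for a f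
          using that D.smult_closed[of a f] D.R.left_idealD(4)[OF Z(1), of a "f s"] s by auto
      qed auto
      then have "?H = {\<zero>\<^bsub>?D\<^esub>} \<or> ?H = carrier ?D"
        using L by (simp add: simple_module_def)
      then show "Z = {\<zero>\<^bsub>?op\<^esub>} \<or> Z = rann R m"
      proof
        assume H: "?H = {\<zero>\<^bsub>?D\<^esub>}"
        have "x = \<zero>\<^bsub>R\<^esub>" if x: "x \<in> Z" for x
        proof -
          have xr: "x \<in> rann R m" using x Z(3) by blast
          then have "functional_at x \<in> ?H" using functional_at_in_dual functional_at_generator x by simp
          then have "functional_at x = \<zero>\<^bsub>?D\<^esub>" using H by blast
          then have "functional_at x s = \<zero>\<^bsub>R\<^esub>" using s by simp
          then show ?thesis using functional_at_generator[OF xr] by simp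
        qed
        then have "Z \<subseteq> {\<zero>\<^bsub>R\<^esub>}" by blast
        then show ?thesis using Z(2) by (intro disjI1 equalityI) simp_all
      next
        assume H: "?H = carrier ?D"
        have "x \<in> Z" if x: "x \<in> rann R m" for x
        proof -
          have "functional_at x \<in> ?H" using H functional_at_in_dual[OF x] by simp
          then show ?thesis using functional_at_generator[OF x] by simp
        qed
        then show ?thesis using Z(3) by blast
      qed
    qed
  }
  {
    assume N: "min_right_ideal R (rann R m)"
    show "simple_module ?op ?D"
      unfolding simple_module_def
    proof (intro conjI allI impI)
      show "left_module ?op ?D" by (rule D.left_module_axioms)
      obtain x where x: "x \<in> rann R m" "x \<noteq> \<zero>\<^bsub>R\<^esub>" using D.R.coversD(3)[OF N] by auto
      have "functional_at x \<noteq> \<zero>\<^bsub>?D\<^esub>"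
      proof
        assume "functional_at x = \<zero>\<^bsub>?D\<^esub>"
        then have "functional_at x s = \<zero>\<^bsub>R\<^esub>" using s by simp
        then show False using functional_at_generator[OF x(1)] x(2) by simp
      qed
      then show "carrier ?D \<noteq> {\<zero>\<^bsub>?D\<^esub>}" using functional_at_in_dual[OF x(1)] by blast
      fix H assume H: "Module.submodule H ?op ?D"
      note HD = D.submoduleD[OF H]
      let ?Z = "(\<lambda>f. f s) ` H"
      have "right_ideal R ?Z"
        unfolding left_ideal_def
      proof (intro conjI ballI)
        show "?Z \<subseteq> carrier ?op" using HD(1) dual_moduleD(1) s by fastforce
        have "\<zero>\<^bsub>?D\<^esub> s \<in> ?Z" using HD(2) by blast
        then show "\<zero>\<^bsub>?op\<^esub> \<in> ?Z" using s by simp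
        fix x assume "x \<in> ?Z"
        then obtain f where f: "f \<in> H" "x = f s" by blast
        { fix y assume "y \<in> ?Z"
          then obtain g where g: "g \<in> H" "y = g s" by blast
          have "(f \<oplus>\<^bsub>?D\<^esub> g) s \<in> ?Z" using HD(3)[OF f(1) g(1)] by blast
          then show "x \<oplus>\<^bsub>?op\<^esub> y \<in> ?Z" using s f g by simp }
        { fix a assume "a \<in> carrier ?op"
          then have "(a \<odot>\<^bsub>?D\<^esub> f) s \<in> ?Z" using HD(4)[OF _ f(1), of a] by blast
          then show "a \<otimes>\<^bsub>?op\<^esub> x \<in> ?Z" using s f by simp }
      qed
      moreover have "?Z \<subseteq> rann R m" using HD(1) dual_apply_s by blast
      moreover from calculation(1) have "{\<zero>\<^bsub>?op\<^esub>} \<subseteq> ?Z" using D.R.left_idealD(2) by blast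
      ultimately have "?Z = {\<zero>\<^bsub>?op\<^esub>} \<or> ?Z = rann R m"
        using D.R.coversD(4)[OF N] by blast
      then show "H = {\<zero>\<^bsub>?D\<^esub>} \<or> H = carrier ?D"
      proof
        assume Z: "?Z = {\<zero>\<^bsub>?op\<^esub>}"
        have "f = \<zero>\<^bsub>?D\<^esub>" if f: "f \<in> H" for f
        proof -
          have "f s \<in> ?Z" using f by blast
          then have "f s = \<zero>\<^bsub>R\<^esub>" using Z by simp
          then show ?thesis by (rule D_zero[OF HD(1)[OF f]])
        qed
        then show ?thesis using HD(2) by blast
      next
        assume Z: "?Z = rann R m"
        have "f \<in> H" if f: "f \<in> carrier ?D" for f
        proof -
          have "f s \<in> ?Z" using Z dual_apply_s[OF f] by simp
          then obtain g where g: "g \<in> H" "f s = g s" by blast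
          then show ?thesis using dual_eqI[OF f HD(1)[OF g(1)]] by simp
        qed
        then show ?thesis using HD(1) by blast
      qed
    qed
  }
qed

lemma reflexive_double_annihilator:
  assumes refl: "reflexive_module R M" and a: "a \<in> carrier R"
    and 0: "\<And>x. x \<in> rann R m \<Longrightarrow> a \<otimes>\<^bsub>R\<^esub> x = \<zero>\<^bsub>R\<^esub>"
  shows "a \<in> m"
proof -
  have inj: "inj_on (evaluation_map R M) (carrier M)"
    using refl by (auto simp: reflexive_module_def bij_betw_def)
  have z: "\<zero>\<^bsub>M\<^esub> = \<zero>\<^bsub>R\<^esub> \<odot>\<^bsub>M\<^esub> s" using s by (simp add: smult_l_null)
  have f0: "f (a \<odot>\<^bsub>M\<^esub> s) = f \<zero>\<^bsub>M\<^esub>" if f: "f \<in> carrier (dual_module R M)" for f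
  proof -
    have "f (a \<odot>\<^bsub>M\<^esub> s) = \<zero>\<^bsub>R\<^esub>" using dual_apply[OF f a] 0[OF dual_apply_s[OF f]] by simp
    moreover have "f \<zero>\<^bsub>M\<^esub> = \<zero>\<^bsub>R\<^esub>"
      using dual_apply[OF f R.zero_closed] dual_moduleD(1)[OF f s(1)] z by simp
    ultimately show ?thesis by simp
  qed
  have "evaluation_map R M (a \<odot>\<^bsub>M\<^esub> s) = evaluation_map R M \<zero>\<^bsub>M\<^esub>"
    unfolding evaluation_map_def using smult_closed[OF a s(1)] f0
    by (auto intro!: restrict_ext)
  then have "a \<odot>\<^bsub>M\<^esub> s = \<zero>\<^bsub>M\<^esub>"
    by (rule inj_onD[OF inj]) (use smult_closed[OF a s(1)] in auto)
  then show ?thesis using a by (simp add: ann_def)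
qed

text \<open>The homomorphism \<open>g\<close> corresponds to an element \<open>G\<close> of the bidual, which is evaluation at some \<open>c s\<close>.\<close>

lemma reflexive_hom_left_multiplication:
  assumes refl: "reflexive_module R M"
    and g: "\<And>x. x \<in> rann R m \<Longrightarrow> g x \<in> carrier R"
      "\<And>x y. x \<in> rann R m \<Longrightarrow> y \<in> rann R m \<Longrightarrow> g (x \<oplus>\<^bsub>R\<^esub> y) = g x \<oplus>\<^bsub>R\<^esub> g y"
      "\<And>x a. x \<in> rann R m \<Longrightarrow> a \<in> carrier R \<Longrightarrow> g (x \<otimes>\<^bsub>R\<^esub> a) = g x \<otimes>\<^bsub>R\<^esub> a"
  shows "\<exists>c\<in>carrier R. \<forall>x\<in>rann R m. g x = c \<otimes>\<^bsub>R\<^esub> x"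
proof -
  let ?D = "dual_module R M"
  define G where "G = (\<lambda>f\<in>carrier ?D. g (f s))"
  interpret D: left_module "opposite_ring R" ?D
    by (rule dual_module_is_right_module[OF left_module_axioms])
  have "G \<in> carrier (bidual_module R M)"
  proof (rule dual_moduleI)
    show "G \<in> extensional (carrier ?D)" by (simp add: G_def)
    fix f assume f: "f \<in> carrier ?D"
    then show "G f \<in> carrier (opposite_ring R)" using g(1)[OF dual_apply_s] by (simp add: G_def)
    { fix h assume h: "h \<in> carrier ?D"
      have "(f \<oplus>\<^bsub>?D\<^esub> h) s = f s \<oplus>\<^bsub>R\<^esub> h s" using s by simp
      then show "G (f \<oplus>\<^bsub>?D\<^esub> h) = G f \<oplus>\<^bsub>opposite_ring R\<^esub> G h"
        using g(2)[OF dual_apply_s[OF f] dual_apply_s[OF h]] D.M.a_closed[OF f h] f h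
        unfolding G_def by (simp del: dual_module_simps) }
    { fix a assume a: "a \<in> carrier (opposite_ring R)"
      have "(a \<odot>\<^bsub>?D\<^esub> f) s = f s \<otimes>\<^bsub>R\<^esub> a" using s by simp
      then show "G (a \<odot>\<^bsub>?D\<^esub> f) = a \<otimes>\<^bsub>opposite_ring R\<^esub> G f"
        using g(3)[OF dual_apply_s[OF f], of a] D.smult_closed[OF a f] a f
        unfolding G_def by (simp del: dual_module_simps) }
  qed
  then have "G \<in> evaluation_map R M ` carrier M"
    using refl by (simp add: reflexive_module_def bij_betw_def)
  then obtain t where t: "t \<in> carrier M" "evaluation_map R M t = G" by blast
  obtain c where c: "c \<in> carrier R" "t = c \<odot>\<^bsub>M\<^esub> s" using generates t by blast
  have "g x = c \<otimes>\<^bsub>R\<^esub> x" if x: "x \<in> rann R m" for x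
  proof -
    let ?f = "functional_at x"
    have f: "?f \<in> carrier ?D" by (rule functional_at_in_dual[OF x])
    have "evaluation_map R M t ?f = ?f t" using t(1) f by (simp add: evaluation_map_def)
    then have "g (?f s) = ?f t" using t(2) f by (simp add: G_def)
    then show ?thesis using functional_at_generator[OF x] functional_at_smult[OF x c(1)] c(2) by simp
  qed
  then show ?thesis using c by blast
qed

lemma ann_smult: "c \<in> carrier R \<Longrightarrow> ann R M (c \<odot>\<^bsub>M\<^esub> s) = colon R m c"
  using s by (auto simp: ann_def colon_def smult_assoc)

text \<open>Together with \<open>core_eq_if_subset\<close>: isomorphic simple modules have the same annihilator.\<close>

lemma core_subset_if_isomorphic:
  assumes N: "simple_module R N" and iso: "isomorphic_modules R N M"
    and t: "t \<in> carrier N" "t \<noteq> \<zero>\<^bsub>N\<^esub>"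
  shows "core R m \<subseteq> core R (ann R N t)"
proof -
  interpret N: left_module R N using N by (simp add: simple_module_def)
  obtain f where f: "f \<in> left_module_hom R N M" and bij: "bij_betw f (carrier N) (carrier M)"
    using iso by (auto simp: isomorphic_modules_def)
  have ft: "f t \<in> carrier M" using f t by (auto simp: left_module_hom_def)
  have fs: "f (a \<odot>\<^bsub>N\<^esub> x) = a \<odot>\<^bsub>M\<^esub> f x" if "a \<in> carrier R" "x \<in> carrier N" for a x
    using f that by (auto simp: left_module_hom_def)
  have "f \<zero>\<^bsub>N\<^esub> = \<zero>\<^bsub>R\<^esub> \<odot>\<^bsub>M\<^esub> f t"
    using fs[OF R.zero_closed t(1)] N.smult_l_null[OF t(1)] by simp
  then have f0: "f \<zero>\<^bsub>N\<^esub> = \<zero>\<^bsub>M\<^esub>" using smult_l_null[OF ft] by simp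
  have "a \<odot>\<^bsub>N\<^esub> t = \<zero>\<^bsub>N\<^esub> \<longleftrightarrow> a \<odot>\<^bsub>M\<^esub> f t = \<zero>\<^bsub>M\<^esub>" if a: "a \<in> carrier R" for a
    using fs[OF a t(1)] f0 inj_onD[OF bij_betw_imp_inj_on[OF bij], of "a \<odot>\<^bsub>N\<^esub> t" "\<zero>\<^bsub>N\<^esub>"]
      N.smult_closed[OF a t(1)] N.M.zero_closed by auto
  then have "ann R N t = ann R M (f t)" by (auto simp: ann_def)
  moreover obtain c where "c \<in> carrier R" "f t = c \<odot>\<^bsub>M\<^esub> s" using generates[OF ft] by blast
  ultimately show ?thesis using ann_smult R.core_subset_core_colon by simp
qed

end

text \<open>The module \<open>R / m\<close>, realized on a set of representatives \<open>r a\<close> of the cosets so that its elements have the type of the elements of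
\<open>R\<close>.\<close>

lemma (in ring) ex_simple_module_with_annihilator:
  assumes m: "max_left_ideal R m"
  shows "\<exists>(S :: ('a, 'a) module) s. simple_left_module R S s \<and> ann R S s = m"
proof -
  note I = coversD(1)[OF m]
  define r where "r a = (SOME b. b \<in> carrier R \<and> a \<ominus> b \<in> m)" for a
  have r: "r a \<in> carrier R" "a \<ominus> r a \<in> m" if "a \<in> carrier R" for a
  proof -
    have "\<exists>b. b \<in> carrier R \<and> a \<ominus> b \<in> m"
      using that left_idealD(2)[OF I] by (intro exI[of _ a]) (simp add: a_minus_def r_neg)
    from someI_ex[OF this] show "r a \<in> carrier R" "a \<ominus> r a \<in> m" unfolding r_def by auto
  qed
  have r_cong: "r a = r b" if ab: "a \<in> carrier R" "b \<in> carrier R" "a \<ominus> b \<in> m" for a b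
  proof -
    have "a \<ominus> c \<in> m \<longleftrightarrow> b \<ominus> c \<in> m" if c: "c \<in> carrier R" for c
    proof (rule left_ideal_minus_iff[OF I])
      have "(a \<ominus> c) \<ominus> (b \<ominus> c) = (a \<ominus> b) \<oplus> (c \<ominus> c)"
        using ab c by (simp add: a_minus_def minus_add a_ac)
      then show "(a \<ominus> c) \<ominus> (b \<ominus> c) \<in> m" using ab c by (simp add: a_minus_def r_neg)
    qed (use ab c in auto)
    then show ?thesis unfolding r_def by (intro arg_cong[of _ _ Eps] ext) auto
  qed
  have r_eq: "r a = r b \<longleftrightarrow> a \<ominus> b \<in> m" if ab: "a \<in> carrier R" "b \<in> carrier R" for a b
  proof
    assume eq: "r a = r b"
    have "(a \<ominus> r a) \<ominus> (b \<ominus> r b) \<in> m" by (rule left_ideal_minus[OF I r(2)[OF ab(1)] r(2)[OF ab(2)]])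
    moreover have "(a \<ominus> r a) \<ominus> (b \<ominus> r b) = (a \<ominus> b) \<oplus> (r b \<ominus> r a)"
      using ab r by (simp add: a_minus_def minus_add a_ac)
    ultimately show "a \<ominus> b \<in> m" using ab r(1)[OF ab(2)] eq by (simp add: a_minus_def r_neg)
  qed (rule r_cong[OF ab])
  define S :: "('a, 'a) module" where "S =
    \<lparr>carrier = r ` carrier R, monoid.mult = undefined, one = undefined, zero = r \<zero>,
     add = (\<lambda>u v. r (u \<oplus> v)), smult = (\<lambda>a u. r (a \<otimes> u))\<rparr>"
  have S: "carrier S = r ` carrier R" "\<zero>\<^bsub>S\<^esub> = r \<zero>" "u \<oplus>\<^bsub>S\<^esub> v = r (u \<oplus> v)" "a \<odot>\<^bsub>S\<^esub> u = r (a \<otimes> u)"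
    for a u v by (simp_all add: S_def)
  have r_add: "r (r a \<oplus> r b) = r (a \<oplus> b)" if ab: "a \<in> carrier R" "b \<in> carrier R" for a b
  proof (rule r_cong[symmetric])
    have "(a \<oplus> b) \<ominus> (r a \<oplus> r b) = (a \<ominus> r a) \<oplus> (b \<ominus> r b)"
      using ab r by (simp add: a_minus_def minus_add a_ac)
    then show "(a \<oplus> b) \<ominus> (r a \<oplus> r b) \<in> m"
      using left_idealD(3)[OF I r(2)[OF ab(1)] r(2)[OF ab(2)]] by simp
  qed (use ab r in auto)
  have r_smult: "r (a \<otimes> r b) = r (a \<otimes> b)" if ab: "a \<in> carrier R" "b \<in> carrier R" for a b
  proof (rule r_cong[symmetric])
    show "a \<otimes> b \<ominus> a \<otimes> r b \<in> m"
      using left_idealD(4)[OF I ab(1) r(2)[OF ab(2)]] ab r by (simp add: r_distr_minus)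
  qed (use ab r in auto)
  have add_S: "r a \<oplus>\<^bsub>S\<^esub> r b = r (a \<oplus> b)" if "a \<in> carrier R" "b \<in> carrier R" for a b
    using that by (simp add: S r_add)
  have smult_S: "a \<odot>\<^bsub>S\<^esub> r b = r (a \<otimes> b)" if "a \<in> carrier R" "b \<in> carrier R" for a b
    using that by (simp add: S r_smult)
  have "abelian_group S"
  proof (rule abelian_groupI)
    fix u assume "u \<in> carrier S"
    then obtain a where a: "a \<in> carrier R" "u = r a" by (auto simp: S(1))
    then have "r (\<ominus> a) \<oplus>\<^bsub>S\<^esub> u = \<zero>\<^bsub>S\<^esub>" using add_S[of "\<ominus> a" a] by (simp add: l_neg S(2))
    moreover have "r (\<ominus> a) \<in> carrier S" using a by (simp add: S(1))
    ultimately show "\<exists>y\<in>carrier S. y \<oplus>\<^bsub>S\<^esub> u = \<zero>\<^bsub>S\<^esub>" by blast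
  next
    show "\<zero>\<^bsub>S\<^esub> \<in> carrier S" by (simp add: S)
  qed (auto simp: S(1,2) add_S a_ac)
  moreover have "left_module_axioms R S"
    by (rule left_module_axioms.intro)
      (auto simp: S(1) add_S smult_S l_distr r_distr m_assoc)
  ultimately have left_S: "left_module R S"
    using ring_axioms by (simp add: left_module_def)
  interpret S: left_module R S by (fact left_S)
  have "H = {\<zero>\<^bsub>S\<^esub>} \<or> H = carrier S" if H: "Module.submodule H R S" for H
  proof -
    note HD = S.submoduleD[OF H]
    let ?J = "{a \<in> carrier R. r a \<in> H}"
    have J: "left_ideal R ?J"
      unfolding left_ideal_def
    proof (intro conjI ballI)
      show "\<zero> \<in> ?J" using HD(2) by (simp add: S)
      show "x \<oplus> y \<in> ?J" if "x \<in> ?J" "y \<in> ?J" for x y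
        using that HD(3)[of "r x" "r y"] by (simp add: add_S)
      show "a \<otimes> x \<in> ?J" if "a \<in> carrier R" "x \<in> ?J" for a x
        using that HD(4)[of a "r x"] by (simp add: smult_S)
    qed auto
    have r0: "r a = \<zero>\<^bsub>S\<^esub> \<longleftrightarrow> a \<in> m" if "a \<in> carrier R" for a
      using r_eq[OF that zero_closed] that by (simp add: S(2) a_minus_def)
    have "x \<in> ?J" if "x \<in> m" for x
      using r0[of x] HD(2) left_idealD(1)[OF I that] that by (metis (mono_tags, lifting) mem_Collect_eq)
    then have "m \<subseteq> ?J" by blast
    then have "?J = m \<or> ?J = carrier R" using coversD(4)[OF m J] by auto
    then show ?thesis
    proof
      assume "?J = m"
      then have "u = \<zero>\<^bsub>S\<^esub>" if "u \<in> H" for u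
        using HD(1)[OF that] that r0 by (auto simp: S(1))
      then show ?thesis using HD(2) by blast
    next
      assume "?J = carrier R"
      then have "carrier S \<subseteq> H" by (auto simp: S(1))
      then show ?thesis using HD(1) by blast
    qed
  qed
  moreover have s: "r \<one> \<in> carrier S" "r \<one> \<noteq> \<zero>\<^bsub>S\<^esub>"
    using r_eq[OF one_closed zero_closed] max_left_ideal_one[OF m] by (auto simp: S a_minus_def)
  ultimately have "simple_module R S"
    using left_S by (auto simp: simple_module_def)
  then have "simple_left_module R S (r \<one>)"
    using s left_S by (simp add: simple_left_module_def simple_left_module_axioms_def)
  moreover have "ann R S (r \<one>) = m"
  proof -
    have "a \<odot>\<^bsub>S\<^esub> r \<one> = \<zero>\<^bsub>S\<^esub> \<longleftrightarrow> a \<in> m" if "a \<in> carrier R" for a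
      using r_eq[OF that zero_closed] that by (simp add: smult_S S(2) a_minus_def)
    then show ?thesis using left_idealD(1)[OF I] by (auto simp: ann_def)
  qed
  ultimately show ?thesis by blast
qed

section \<open>Finite-dimensional algebras\<close>

text \<open>The dimension, defined here as the largest size of a linearly independent subset: a largest independent subset
of \<open>I\<close> stays independent when an element outside \<open>I\<close> is added.\<close>

lemma (in vectorspace) ex_strict_subspace_rank:
  assumes fd: "fin_dim"
  shows "\<exists>d :: 'c set \<Rightarrow> nat. \<forall>I J. LinearCombinations.submodule K I V \<longrightarrow>
    LinearCombinations.submodule K J V \<longrightarrow> I \<subset> J \<longrightarrow> d I < d J"
proof (intro exI allI impI)
  let ?S = "\<lambda>I. card ` {B. B \<subseteq> I \<and> lin_indpt B}"
  fix I J
  assume I: "LinearCombinations.submodule K I V" and J: "LinearCombinations.submodule K J V"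
    and IJ: "I \<subset> J"
  have Ic: "I \<subseteq> carrier V" and Jc: "J \<subseteq> carrier V"
    using I J by (auto simp: LinearCombinations.submodule_def)
  have fin: "finite (?S L)" if "L \<subseteq> carrier V" for L
    by (rule finite_subset[of _ "{..dim}"]) (use that li_le_dim(2)[OF fd] in auto)
  have "lin_indpt {}" by (auto simp: lin_dep_def)
  then have "?S I \<noteq> {}" by blast
  from Max_in[OF fin[OF Ic] this] obtain B where B: "B \<subseteq> I" "lin_indpt B" "card B = Max (?S I)"
    by auto
  have Bc: "B \<subseteq> carrier V" using B Ic by blast
  obtain u where u: "u \<in> J" "u \<notin> I" using IJ by blast
  have "u \<notin> span B" using span_is_subset[OF B(1) I] u by blast
  then have "lin_indpt (B \<union> {u})"
    using lin_dep_iff_in_span[OF Bc B(2), of u] u B(1) Jc by blast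
  moreover have "B \<union> {u} \<subseteq> J" using B IJ u by blast
  ultimately have "card (B \<union> {u}) \<le> Max (?S J)" by (intro Max_ge[OF fin[OF Jc]]) blast
  moreover have "card (B \<union> {u}) = Suc (card B)"
  proof -
    have "u \<notin> B" using u(2) B(1) by blast
    then show ?thesis using li_le_dim(1)[OF fd Bc B(2)] by simp
  qed
  ultimately show "Max (?S I) < Max (?S J)" using B(3) by simp
qed

context fin_dim_algebra
begin

text \<open>\<open>c x = (c 1) x\<close>; for right ideals, \<open>c x = x (c 1)\<close>.\<close>

lemma left_ideal_subspace:
  assumes "left_ideal A I"
  shows "LinearCombinations.submodule K I A"
proof -
  have "c \<odot>\<^bsub>A\<^esub> x \<in> I" if c: "c \<in> carrier K" and x: "x \<in> I" for c x
  proof -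
    have "x \<in> carrier A" by (rule A.left_idealD(1)[OF assms x])
    then have "c \<odot>\<^bsub>A\<^esub> x = (c \<odot>\<^bsub>A\<^esub> \<one>\<^bsub>A\<^esub>) \<otimes>\<^bsub>A\<^esub> x"
      using smult_mult_left[OF c A.one_closed, of x] by simp
    then show ?thesis using A.left_idealD(4)[OF assms _ x] c by simp
  qed
  then show ?thesis
    using assms module_axioms by (auto simp: LinearCombinations.submodule_def left_ideal_def)
qed

lemma right_ideal_subspace:
  assumes "right_ideal A I"
  shows "LinearCombinations.submodule K I A"
proof -
  interpret op: ring "opposite_ring A" by (rule A.ring_opposite_ring)
  have "c \<odot>\<^bsub>A\<^esub> x \<in> I" if c: "c \<in> carrier K" and x: "x \<in> I" for c x
  proof -
    have "x \<in> carrier A" using op.left_idealD(1)[OF assms x] by simp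
    then have "c \<odot>\<^bsub>A\<^esub> x = x \<otimes>\<^bsub>A\<^esub> (c \<odot>\<^bsub>A\<^esub> \<one>\<^bsub>A\<^esub>)"
      using smult_mult_right[OF c _ A.one_closed, of x] by simp
    then show ?thesis using op.left_idealD(4)[OF assms _ x, of "c \<odot>\<^bsub>A\<^esub> \<one>\<^bsub>A\<^esub>"] c by simp
  qed
  then show ?thesis
    using assms module_axioms by (auto simp: LinearCombinations.submodule_def left_ideal_def)
qed

lemma finite_length_ring: "finite_length_ring A"
proof -
  obtain d :: "'a set \<Rightarrow> nat" where d: "\<And>I J. LinearCombinations.submodule K I A \<Longrightarrow>
      LinearCombinations.submodule K J A \<Longrightarrow> I \<subset> J \<Longrightarrow> d I < d J"
    using ex_strict_subspace_rank[OF finite_dimensional] by blast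
  have "left_finite_length A"
    by unfold_locales (use d left_ideal_subspace in blast)
  moreover have "left_finite_length (opposite_ring A)"
    using A.ring_opposite_ring d right_ideal_subspace
    by (auto simp: left_finite_length_def left_finite_length_axioms_def intro!: exI[of _ d])
  ultimately show ?thesis by (simp add: finite_length_ring_def)
qed

end

lemma reflexive_simples_if_modules_reflexive:
  fixes R :: "('a, 'r) ring_scheme"
  assumes R: "finite_length_ring R"
    and refl: "\<forall>S :: ('a, 'a) module. simple_module R S \<longrightarrow> reflexive_module R S"
  shows "reflexive_simples R"
proof -
  interpret finite_length_ring R by (fact R)
  show ?thesis
  proof unfold_locales
    fix m a
    assume m: "max_left_ideal R m" and a: "a \<in> carrier R"
      and 0: "\<And>x. x \<in> rann R m \<Longrightarrow> a \<otimes>\<^bsub>R\<^esub> x = \<zero>\<^bsub>R\<^esub>"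
    obtain S :: "('a, 'a) module" and s where S: "simple_left_module R S s" "ann R S s = m"
      using ex_simple_module_with_annihilator[OF m] by blast
    interpret S: simple_left_module R S s by (fact S(1))
    show "a \<in> m"
      using S.reflexive_double_annihilator[OF _ a] refl S.simple 0 S(2) by blast
  next
    fix m g
    assume m: "max_left_ideal R m"
      and g: "\<And>x. x \<in> rann R m \<Longrightarrow> g x \<in> carrier R"
        "\<And>x y. x \<in> rann R m \<Longrightarrow> y \<in> rann R m \<Longrightarrow> g (x \<oplus>\<^bsub>R\<^esub> y) = g x \<oplus>\<^bsub>R\<^esub> g y"
        "\<And>x a. x \<in> rann R m \<Longrightarrow> a \<in> carrier R \<Longrightarrow> g (x \<otimes>\<^bsub>R\<^esub> a) = g x \<otimes>\<^bsub>R\<^esub> a"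
    obtain S :: "('a, 'a) module" and s where S: "simple_left_module R S s" "ann R S s = m"
      using ex_simple_module_with_annihilator[OF m] by blast
    interpret S: simple_left_module R S s by (fact S(1))
    have "reflexive_module R S" using refl S.simple by blast
    from S.reflexive_hom_left_multiplication[OF this, unfolded S(2), OF g]
    show "\<exists>c\<in>carrier R. \<forall>x\<in>rann R m. g x = c \<otimes>\<^bsub>R\<^esub> x" by simp
  qed
qed

theorem proposition4p3:
  fixes K :: "('k, 'l) ring_scheme"
    and A :: "('k, 'a, 'm) module_scheme"
    and T :: "('a, 't, 'n) module_scheme"
  assumes "algebraically_closed K"
    and "fin_dim_algebra K A"
    and "\<forall>S :: ('a, 'a) module. simple_module A S \<longrightarrow> reflexive_module A S"
    and "simple_module A T"
    and "\<forall>S :: ('a, 'a) module. simple_module A S \<and> \<not> isomorphic_modules A S T \<longrightarrow>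
      simple_module (opposite_ring A) (dual_module A S)"
  shows "simple_module (opposite_ring A) (dual_module A T) \<and> self_injective TYPE('x) A"
proof -
  interpret reflexive_simples A
    by (rule reflexive_simples_if_modules_reflexive
        [OF fin_dim_algebra.finite_length_ring[OF assms(2)] assms(3)])
  have T: "left_module A T" "carrier T \<noteq> {\<zero>\<^bsub>T\<^esub>}"
    using assms(4) by (auto simp: simple_module_def)
  interpret T: left_module A T by (rule T(1))
  obtain t where t: "t \<in> carrier T" "t \<noteq> \<zero>\<^bsub>T\<^esub>" using T(2) T.M.zero_closed by blast
  interpret T: simple_left_module A T t by unfold_locales (use assms(4) t in auto)
  have others: "min_right_ideal A (rann A m)"
    if m: "max_left_ideal A m" and ne: "core A m \<noteq> core A T.m" for m
  proof -
    obtain S :: "('a, 'a) module" and s where S: "simple_left_module A S s" "ann A S s = m"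
      using ex_simple_module_with_annihilator[OF m] by blast
    interpret S: simple_left_module A S s by (fact S(1))
    have "\<not> isomorphic_modules A S T"
    proof
      assume "isomorphic_modules A S T"
      then have "core A T.m \<subseteq> core A m"
        using T.core_subset_if_isomorphic[OF S.simple _ S.s] S(2) by simp
      then show False using core_eq_if_subset[OF T.max_ann m] ne by simp
    qed
    then have "simple_module (opposite_ring A) (dual_module A S)"
      using assms(5) S.simple by blast
    then show ?thesis using S.simple_dual_iff S(2) by simp
  qed
  \<comment> \<open>If \<open>A / m\<close> is isomorphic to \<open>T\<close>, then \<open>others\<close> covers all simple modules not isomorphic to \<open>A / m\<close>.\<close>
  have min: "min_right_ideal A (rann A m)" if m: "max_left_ideal A m" for m
  proof (cases "core A m = core A T.m")
    case True
    show ?thesis by (rule rann_minimal_if_others_minimal[OF m others]) (simp_all add: True)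
  next
    case False
    then show ?thesis by (rule others[OF m])
  qed
  have "self_injective TYPE('x) A"
    by (rule baer_criterion) (rule hom_is_right_multiplication[OF min lann_minimal[OF min]])
  then show ?thesis using min[OF T.max_ann] T.simple_dual_iff by blast
qed

end
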